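(* Let $M$ be a Hausdorff manifold, let $(C,\Delta,\epsilon)$ be a coalgebra over $R=\mathcal{C}^{\infty}_{c}(M)$ and let $x\in M$. Then $(C_{x},\Delta_{x},\epsilon_{x})$ is a coalgebra over the ring $R_{x}=(\mathcal{C}^{\infty}_{M})_{x}$. If $D$ is another coalgebra over $\mathcal{C}^{\infty}_{c}(M)$ and $\alpha:C\to D$ is a homomorphism of coalgebras, then $\alpha_{x}:C_{x}\to D_{x}$ is also a homomorphism of coalgebras.
   Context: $\mathcal{C}^{\infty}_{c}(M)$ is the ring of smooth $\mathbb{F}$-valued ($\mathbb{F}\in\{\mathbb{R},\mathbb{C}\}$ fixed) functions with compact support on $M$; $(\mathcal{C}^{\infty}_{M})_{x}$ is the ring of germs at $x$ of smooth functions; "$f_{x}=1$" means that the germ of $f$ at $x$ is that of the constant $1$. For a commutative ring $R$ with local identities (for all $r_{1},\dots,r_{k}\in R$ there is $r\in R$ with $rr_{i}=r_{i}$ for all $i$), a left $R$-module $C$ is locally unitary if for all $c_{1},\dots,c_{k}\in C$ there is $r\in R$ with $rc_{i}=c_{i}$ for all $i$. A coalgebra over $R$ is a locally unitary $R$-module $C$ with $R$-linear maps $\Delta:C\to C\otimes_{R}C$ and $\epsilon:C\to R$ with $(\mathrm{id}\otimes\epsilon)\circ\Delta=\mathrm{id}=(\epsilon\otimes\mathrm{id})\circ\Delta$, where $C$, $R\otimes_{R}C$, $C\otimes_{R}R$ are identified (coassociativity and cocommutativity are not assumed). Homomorphisms are $R$-linear maps $\alpha$ with $(\alpha\otimes\alpha)\circ\Delta=\Delta\circ\alpha$,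 $\epsilon\circ\alpha=\epsilon$. For $R=\mathcal{C}^{\infty}_{c}(M)$, a left $R$-module $C$ and $x\in M$, put $N_{x}(C)=\{c\in C: fc=0$ for some $f\in\mathcal{C}^{\infty}_{c}(M)$ with $f_{x}=1\}$ and $C_{x}=C/N_{x}(C)$. For $C=R$ one gets $R_{x}=(\mathcal{C}^{\infty}_{M})_{x}$, and the $R$-action on $C_{x}$ factors through $R_{x}$. Every $R$-linear map $\alpha:C\to D$ satisfies $\alpha(N_{x}(C))\subset N_{x}(D)$ and induces an $R_{x}$-linear map $\alpha_{x}:C_{x}\to D_{x}$. The kernel of the canonical surjection $C\otimes_{R}C\to C_{x}\otimes_{R}C_{x}=C_{x}\otimes_{R_{x}}C_{x}$ is $N_{x}(C\otimes_{R}C)$, so $(C\otimes_{R}C)_{x}$ is identified with $C_{x}\otimes_{R_{x}}C_{x}$; with this identification $\Delta_{x}:C_{x}\to C_{x}\otimes_{R_{x}}C_{x}$ and $\epsilon_{x}:C_{x}\to R_{x}$ are the maps induced by $\Delta$ and $\epsilon$. *)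

theory Defs
  imports "HOL-Analysis.Analysis" "HOL-Algebra.Free_Abelian_Groups"
    "HOL-Algebra.Generated_Groups" "HOL-Algebra.AbelCoset" "HOL-Algebra.Module"
begin

section \<open>Smooth manifolds\<close>

text \<open>
  Functions on \<open>\<real>\<^sup>n\<close>, that is on \<^const>\<open>Euclidean_space\<close> \<open>n\<close>, of class \<open>C\<^sup>k\<close> on an open set \<open>U\<close>:
  all partial derivatives up to order \<open>k\<close> exist and are continuous on \<open>U\<close>.  The case \<open>n = 0\<close> is
  included.  Since \<open>U\<close> is open, \<open>v(i := t)\<close> stays in \<open>U\<close> for \<open>t\<close> near \<open>v i\<close>.
\<close>

primrec C_on :: "nat \<Rightarrow> nat \<Rightarrow> (nat \<Rightarrow> real) set \<Rightarrow> ((nat \<Rightarrow> real) \<Rightarrow> 'b::real_normed_vector) \<Rightarrow> bool"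
  where
    "C_on 0 n U f \<longleftrightarrow> continuous_map (subtopology (Euclidean_space n) U) euclidean f"
  | "C_on (Suc k) n U f \<longleftrightarrow>
       continuous_map (subtopology (Euclidean_space n) U) euclidean f \<and>
       (\<exists>f'. \<forall>i<n.
          (\<forall>v\<in>U. ((\<lambda>t. f (v(i := t))) has_vector_derivative f' i v) (at (v i))) \<and>
          C_on k n U (f' i))"

definition smooth_on_Rn ::
    "nat \<Rightarrow> (nat \<Rightarrow> real) set \<Rightarrow> ((nat \<Rightarrow> real) \<Rightarrow> 'b::real_normed_vector) \<Rightarrow> bool"
  where "smooth_on_Rn n U f \<longleftrightarrow> (\<forall>k. C_on k n U f)"

type_synonym 'm chart = "'m set \<times> ('m \<Rightarrow> nat \<Rightarrow> real)"

definition is_chart :: "nat \<Rightarrow> 'm::topological_space chart \<Rightarrow> bool"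
  where "is_chart n = (\<lambda>(U, \<phi>). open U \<and>
    (\<exists>V. openin (Euclidean_space n) V \<and>
         homeomorphic_map (top_of_set U) (subtopology (Euclidean_space n) V) \<phi>))"

text \<open>
  The manifold is the whole type \<open>'m\<close>; it is Hausdorff because of the sort \<open>t2_space\<close>.
  Neither second countability nor paracompactness is required.
\<close>

definition smooth_atlas :: "nat \<Rightarrow> 'm::t2_space chart set \<Rightarrow> bool"
  where "smooth_atlas n A \<longleftrightarrow>
    (\<forall>c\<in>A. is_chart n c) \<and> \<Union>(fst ` A) = UNIV \<and>
    (\<forall>(U, \<phi>)\<in>A. \<forall>(V, \<psi>)\<in>A. \<forall>i<n.
       smooth_on_Rn n (\<phi> ` (U \<inter> V)) (\<lambda>v. \<psi> (inv_into U \<phi> v) i))"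

definition smooth_fun :: "nat \<Rightarrow> 'm::t2_space chart set \<Rightarrow> 'm set \<Rightarrow> ('m \<Rightarrow> 'f::real_normed_vector) \<Rightarrow> bool"
  where "smooth_fun n A W f \<longleftrightarrow>
    (\<forall>(U, \<phi>)\<in>A. smooth_on_Rn n (\<phi> ` (U \<inter> W)) (\<lambda>v. f (inv_into U \<phi> v)))"

text \<open>
  The scalars are a type of class \<open>real_normed_field\<close>; by the Gelfand-Mazur theorem
  these are precisely \<open>\<real>\<close> and \<open>\<complex>\<close> up to isomorphism.  The field \<open>one\<close> of the record below
  belongs to the carrier only if the manifold is compact; it is not used otherwise.
\<close>

definition Cc_ring :: "nat \<Rightarrow> 'm::t2_space chart set \<Rightarrow> ('m \<Rightarrow> 'f::real_normed_field) ring"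
  where "Cc_ring n A = \<lparr>
    carrier = {f. smooth_fun n A UNIV f \<and> compact (closure {y. f y \<noteq> 0})},
    mult = (\<lambda>f g y. f y * g y),
    one = (\<lambda>y. 1),
    zero = (\<lambda>y. 0),
    add = (\<lambda>f g y. f y + g y)\<rparr>"

text \<open>
  The germ at \<open>x\<close> of a function \<open>f\<close> that is smooth near \<open>x\<close> is the equivalence class of \<open>f\<close> among
  all functions smooth near \<open>x\<close>.  Locally defined functions are represented by arbitrary total
  extensions.
\<close>

definition germ :: "nat \<Rightarrow> 'm::t2_space chart set \<Rightarrow> 'm \<Rightarrow> ('m \<Rightarrow> 'f::real_normed_field) \<Rightarrow> ('m \<Rightarrow> 'f) set"
  where "germ n A x f =
    {g. \<exists>W. open W \<and> x \<in> W \<and> smooth_fun n A W g \<and> (\<forall>y\<in>W. g y = f y)}"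

definition germ_ring :: "nat \<Rightarrow> 'm::t2_space chart set \<Rightarrow> 'm \<Rightarrow> ('m \<Rightarrow> 'f::real_normed_field) set ring"
  where "germ_ring n A x = \<lparr>
    carrier = {germ n A x f | f. \<exists>W. open W \<and> x \<in> W \<and> smooth_fun n A W f},
    mult = (\<lambda>X Y. \<Union>f\<in>X. \<Union>g\<in>Y. germ n A x (\<lambda>y. f y * g y)),
    one = germ n A x (\<lambda>y. 1),
    zero = germ n A x (\<lambda>y. 0),
    add = (\<lambda>X Y. \<Union>f\<in>X. \<Union>g\<in>Y. germ n A x (\<lambda>y. f y + g y))\<rparr>"


section \<open>Locally unitary modules and tensor products\<close>

text \<open>No identity element is assumed, and the \<open>one\<close> fields of the records are ignored.\<close>

locale local_units_ring = abelian_group R for R (structure) +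
  assumes mult_closed: "a \<in> carrier R \<Longrightarrow> b \<in> carrier R \<Longrightarrow> a \<otimes> b \<in> carrier R"
    and mult_assoc: "a \<in> carrier R \<Longrightarrow> b \<in> carrier R \<Longrightarrow> c \<in> carrier R \<Longrightarrow>
      (a \<otimes> b) \<otimes> c = a \<otimes> (b \<otimes> c)"
    and mult_comm: "a \<in> carrier R \<Longrightarrow> b \<in> carrier R \<Longrightarrow> a \<otimes> b = b \<otimes> a"
    and distr: "a \<in> carrier R \<Longrightarrow> b \<in> carrier R \<Longrightarrow> c \<in> carrier R \<Longrightarrow>
      (a \<oplus> b) \<otimes> c = (a \<otimes> c) \<oplus> (b \<otimes> c)"
    and local_units: "finite F \<Longrightarrow> F \<subseteq> carrier R \<Longrightarrow> \<exists>r\<in>carrier R. \<forall>a\<in>F. r \<otimes> a = a"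

locale locally_unitary_module = R?: local_units_ring R + M?: abelian_group M
  for R (structure) and M (structure) +
  assumes smult_closed: "a \<in> carrier R \<Longrightarrow> x \<in> carrier M \<Longrightarrow> a \<odot>\<^bsub>M\<^esub> x \<in> carrier M"
    and smult_l_distr: "a \<in> carrier R \<Longrightarrow> b \<in> carrier R \<Longrightarrow> x \<in> carrier M \<Longrightarrow>
      (a \<oplus>\<^bsub>R\<^esub> b) \<odot>\<^bsub>M\<^esub> x = a \<odot>\<^bsub>M\<^esub> x \<oplus>\<^bsub>M\<^esub> b \<odot>\<^bsub>M\<^esub> x"
    and smult_r_distr: "a \<in> carrier R \<Longrightarrow> x \<in> carrier M \<Longrightarrow> y \<in> carrier M \<Longrightarrow>
      a \<odot>\<^bsub>M\<^esub> (x \<oplus>\<^bsub>M\<^esub> y) = a \<odot>\<^bsub>M\<^esub> x \<oplus>\<^bsub>M\<^esub> a \<odot>\<^bsub>M\<^esub> y"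
    and smult_assoc: "a \<in> carrier R \<Longrightarrow> b \<in> carrier R \<Longrightarrow> x \<in> carrier M \<Longrightarrow>
      (a \<otimes>\<^bsub>R\<^esub> b) \<odot>\<^bsub>M\<^esub> x = a \<odot>\<^bsub>M\<^esub> (b \<odot>\<^bsub>M\<^esub> x)"
    and locally_unitary: "finite F \<Longrightarrow> F \<subseteq> carrier M \<Longrightarrow> \<exists>r\<in>carrier R. \<forall>c\<in>F. r \<odot>\<^bsub>M\<^esub> c = c"

definition linear_maps ::
    "('r, 's) ring_scheme \<Rightarrow> ('r, 'c, 'p) module_scheme \<Rightarrow> ('r, 'd, 'q) module_scheme \<Rightarrow> ('c \<Rightarrow> 'd) set"
  where "linear_maps R C D = {\<alpha> \<in> carrier C \<rightarrow> carrier D.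
    (\<forall>c\<in>carrier C. \<forall>c'\<in>carrier C. \<alpha> (c \<oplus>\<^bsub>C\<^esub> c') = \<alpha> c \<oplus>\<^bsub>D\<^esub> \<alpha> c') \<and>
    (\<forall>r\<in>carrier R. \<forall>c\<in>carrier C. \<alpha> (r \<odot>\<^bsub>C\<^esub> c) = r \<odot>\<^bsub>D\<^esub> \<alpha> c)}"

definition regular_module :: "('r, 's) ring_scheme \<Rightarrow> ('r, 'r) module"
  where "regular_module R = \<lparr>
    carrier = carrier R, mult = mult R, one = one R, zero = zero R, add = add R,
    smult = mult R\<rparr>"

text \<open>
  \<open>C \<otimes>\<^sub>R D\<close> is the quotient of the free abelian group on \<open>C \<times> D\<close> by the subgroup generated by
  the biadditivity and balancing relators.  Its elements are cosets of that subgroup.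
\<close>

definition tensor_relators ::
    "('r, 's) ring_scheme \<Rightarrow> ('r, 'c, 'p) module_scheme \<Rightarrow> ('r, 'd, 'q) module_scheme
      \<Rightarrow> (('c \<times> 'd) \<Rightarrow>\<^sub>0 int) set"
  where "tensor_relators R C D =
    {frag_of (c \<oplus>\<^bsub>C\<^esub> c', d) - frag_of (c, d) - frag_of (c', d) | c c' d.
       c \<in> carrier C \<and> c' \<in> carrier C \<and> d \<in> carrier D} \<union>
    {frag_of (c, d \<oplus>\<^bsub>D\<^esub> d') - frag_of (c, d) - frag_of (c, d') | c d d'.
       c \<in> carrier C \<and> d \<in> carrier D \<and> d' \<in> carrier D} \<union>
    {frag_of (r \<odot>\<^bsub>C\<^esub> c, d) - frag_of (c, r \<odot>\<^bsub>D\<^esub> d) | r c d.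
       r \<in> carrier R \<and> c \<in> carrier C \<and> d \<in> carrier D}"

definition tensor_null ::
    "('r, 's) ring_scheme \<Rightarrow> ('r, 'c, 'p) module_scheme \<Rightarrow> ('r, 'd, 'q) module_scheme
      \<Rightarrow> (('c \<times> 'd) \<Rightarrow>\<^sub>0 int) set"
  where "tensor_null R C D =
    generate (free_Abelian_group (carrier C \<times> carrier D)) (tensor_relators R C D)"

definition tensor_class ::
    "('r, 's) ring_scheme \<Rightarrow> ('r, 'c, 'p) module_scheme \<Rightarrow> ('r, 'd, 'q) module_scheme
      \<Rightarrow> (('c \<times> 'd) \<Rightarrow>\<^sub>0 int) \<Rightarrow> (('c \<times> 'd) \<Rightarrow>\<^sub>0 int) set"
  where "tensor_class R C D z =
    tensor_null R C D #>\<^bsub>free_Abelian_group (carrier C \<times> carrier D)\<^esub> z"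

definition pure_tensor ::
    "('r, 's) ring_scheme \<Rightarrow> ('r, 'c, 'p) module_scheme \<Rightarrow> ('r, 'd, 'q) module_scheme
      \<Rightarrow> 'c \<Rightarrow> 'd \<Rightarrow> (('c \<times> 'd) \<Rightarrow>\<^sub>0 int) set"
  where "pure_tensor R C D c d = tensor_class R C D (frag_of (c, d))"

text \<open>
  The scalar action is \<open>r (c \<otimes> d) = r c \<otimes> d\<close>, extended additively; the choice of the
  representative is immaterial.
\<close>

definition tensor_product ::
    "('r, 's) ring_scheme \<Rightarrow> ('r, 'c, 'p) module_scheme \<Rightarrow> ('r, 'd, 'q) module_scheme
      \<Rightarrow> ('r, (('c \<times> 'd) \<Rightarrow>\<^sub>0 int) set) module"
  where "tensor_product R C D =
    (let G = free_Abelian_group (carrier C \<times> carrier D); N = tensor_null R C D in \<lparr>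
      carrier = rcosets\<^bsub>G\<^esub> N,
      mult = undefined,
      one = undefined,
      zero = N,
      add = set_mult G,
      smult = (\<lambda>r X. tensor_class R C D
        (frag_extend (\<lambda>(c, d). frag_of (r \<odot>\<^bsub>C\<^esub> c, d)) (SOME z. z \<in> X)))\<rparr>)"

text \<open>
  The additive map \<open>C \<otimes>\<^sub>R D \<rightarrow> E\<close> with \<open>c \<otimes> d \<mapsto> \<phi> c d\<close>, for a biadditive and balanced \<open>\<phi>\<close>.
  For such \<open>\<phi>\<close> the choice of the representative is immaterial.
\<close>

definition tensor_lift ::
    "('e, 'q) ring_scheme \<Rightarrow> ('c \<Rightarrow> 'd \<Rightarrow> 'e) \<Rightarrow> (('c \<times> 'd) \<Rightarrow>\<^sub>0 int) set \<Rightarrow> 'e"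
  where "tensor_lift E \<phi> X =
    (let z = (SOME z. z \<in> X) in
      \<Oplus>\<^bsub>E\<^esub>p \<in> Poly_Mapping.keys z. [Poly_Mapping.lookup z p] \<cdot>\<^bsub>E\<^esub> \<phi> (fst p) (snd p))"

definition tensor_map ::
    "('r, 's) ring_scheme \<Rightarrow> ('r, 'c2, 'p) module_scheme \<Rightarrow> ('r, 'd2, 'q) module_scheme
      \<Rightarrow> ('c1 \<Rightarrow> 'c2) \<Rightarrow> ('d1 \<Rightarrow> 'd2) \<Rightarrow> (('c1 \<times> 'd1) \<Rightarrow>\<^sub>0 int) set \<Rightarrow> (('c2 \<times> 'd2) \<Rightarrow>\<^sub>0 int) set"
  where "tensor_map R C' D' \<alpha> \<beta> =
    tensor_lift (tensor_product R C' D') (\<lambda>c d. pure_tensor R C' D' (\<alpha> c) (\<beta> d))"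


section \<open>Coalgebras\<close>

text \<open>
  The two lifts in the counit axioms are the identifications \<open>C \<otimes>\<^sub>R R = C\<close> and \<open>R \<otimes>\<^sub>R C = C\<close>.
\<close>

locale coalgebra = locally_unitary_module R C for R (structure) and C (structure) +
  fixes \<Delta> \<epsilon>
  assumes comult_linear: "\<Delta> \<in> linear_maps R C (tensor_product R C C)"
    and counit_linear: "\<epsilon> \<in> linear_maps R C (regular_module R)"
    and counit_right: "c \<in> carrier C \<Longrightarrow>
      tensor_lift C (\<lambda>c' r. r \<odot>\<^bsub>C\<^esub> c') (tensor_map R C (regular_module R) id \<epsilon> (\<Delta> c)) = c"
    and counit_left: "c \<in> carrier C \<Longrightarrow>
      tensor_lift C (\<lambda>r c'. r \<odot>\<^bsub>C\<^esub> c') (tensor_map R (regular_module R) C \<epsilon> id (\<Delta> c)) = c"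

definition coalgebra_hom ::
    "('r, 's) ring_scheme
      \<Rightarrow> ('r, 'c, 'p) module_scheme \<Rightarrow> ('c \<Rightarrow> (('c \<times> 'c) \<Rightarrow>\<^sub>0 int) set) \<Rightarrow> ('c \<Rightarrow> 'r)
      \<Rightarrow> ('r, 'd, 'q) module_scheme \<Rightarrow> ('d \<Rightarrow> (('d \<times> 'd) \<Rightarrow>\<^sub>0 int) set) \<Rightarrow> ('d \<Rightarrow> 'r)
      \<Rightarrow> ('c \<Rightarrow> 'd) \<Rightarrow> bool"
  where "coalgebra_hom R C \<Delta>C \<epsilon>C D \<Delta>D \<epsilon>D \<alpha> \<longleftrightarrow>
    \<alpha> \<in> linear_maps R C D \<and>
    (\<forall>c\<in>carrier C. tensor_map R D D \<alpha> \<alpha> (\<Delta>C c) = \<Delta>D (\<alpha> c)) \<and>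
    (\<forall>c\<in>carrier C. \<epsilon>D (\<alpha> c) = \<epsilon>C c)"


section \<open>Localization at a point\<close>

definition stalk_null ::
    "nat \<Rightarrow> 'm::t2_space chart set \<Rightarrow> 'm \<Rightarrow> ('m \<Rightarrow> 'f::real_normed_field, 'c, 'p) module_scheme \<Rightarrow> 'c set"
  where "stalk_null n A x C = {c \<in> carrier C. \<exists>f \<in> carrier (Cc_ring n A).
    germ n A x f = germ n A x (\<lambda>y. 1) \<and> f \<odot>\<^bsub>C\<^esub> c = \<zero>\<^bsub>C\<^esub>}"

text \<open>
  \<open>C\<^sub>x\<close> as a module over the ring of germs: a germ acts through any compactly supported global
  function that represents it.
\<close>

definition stalk ::
    "nat \<Rightarrow> 'm::t2_space chart set \<Rightarrow> 'm \<Rightarrow> ('m \<Rightarrow> 'f::real_normed_field, 'c, 'p) module_scheme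
      \<Rightarrow> (('m \<Rightarrow> 'f) set, 'c set) module"
  where "stalk n A x C = \<lparr>
    carrier = a_rcosets\<^bsub>C\<^esub> (stalk_null n A x C),
    mult = undefined,
    one = undefined,
    zero = stalk_null n A x C,
    add = set_add C,
    smult = (\<lambda>g X. \<Union>f \<in> g \<inter> carrier (Cc_ring n A). \<Union>c\<in>X. stalk_null n A x C +>\<^bsub>C\<^esub> (f \<odot>\<^bsub>C\<^esub> c))\<rparr>"

definition stalk_map ::
    "nat \<Rightarrow> 'm::t2_space chart set \<Rightarrow> 'm \<Rightarrow> ('m \<Rightarrow> 'f::real_normed_field, 'd, 'q) module_scheme
      \<Rightarrow> ('c \<Rightarrow> 'd) \<Rightarrow> 'c set \<Rightarrow> 'd set"
  where "stalk_map n A x D \<alpha> X = (\<Union>c\<in>X. stalk_null n A x D +>\<^bsub>D\<^esub> \<alpha> c)"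

text \<open>The identification \<open>R / N\<^sub>x(R) \<rightarrow> (C\<^sup>\<infinity>\<^sub>M)\<^sub>x\<close>; all elements of a coset have the same germ.\<close>

definition stalk_to_germ ::
    "nat \<Rightarrow> 'm::t2_space chart set \<Rightarrow> 'm \<Rightarrow> ('m \<Rightarrow> 'f::real_normed_field) set \<Rightarrow> ('m \<Rightarrow> 'f) set"
  where "stalk_to_germ n A x Y = (\<Union>f\<in>Y. germ n A x f)"

text \<open>
  The identification of \<open>(C \<otimes>\<^sub>R C)\<^sub>x\<close> with the tensor product of \<open>C\<^sub>x\<close> with itself over the ring of
  germs, induced by \<open>c \<otimes> c' \<mapsto> [c] \<otimes> [c']\<close>.
\<close>

definition stalk_tensor ::
    "nat \<Rightarrow> 'm::t2_space chart set \<Rightarrow> 'm \<Rightarrow> ('m \<Rightarrow> 'f::real_normed_field, 'c, 'p) module_scheme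
      \<Rightarrow> (('c \<times> 'c) \<Rightarrow>\<^sub>0 int) set set \<Rightarrow> (('c set \<times> 'c set) \<Rightarrow>\<^sub>0 int) set"
  where "stalk_tensor n A x C Y =
    (let S = germ_ring n A x; Cx = stalk n A x C; N = stalk_null n A x C in
      tensor_lift (tensor_product S Cx Cx)
        (\<lambda>c c'. pure_tensor S Cx Cx (N +>\<^bsub>C\<^esub> c) (N +>\<^bsub>C\<^esub> c')) (SOME t. t \<in> Y))"

definition stalk_comult ::
    "nat \<Rightarrow> 'm::t2_space chart set \<Rightarrow> 'm \<Rightarrow> ('m \<Rightarrow> 'f::real_normed_field, 'c, 'p) module_scheme
      \<Rightarrow> ('c \<Rightarrow> (('c \<times> 'c) \<Rightarrow>\<^sub>0 int) set) \<Rightarrow> 'c set \<Rightarrow> (('c set \<times> 'c set) \<Rightarrow>\<^sub>0 int) set"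
  where "stalk_comult n A x C \<Delta> =
    stalk_tensor n A x C \<circ> stalk_map n A x (tensor_product (Cc_ring n A) C C) \<Delta>"

definition stalk_counit ::
    "nat \<Rightarrow> 'm::t2_space chart set \<Rightarrow> 'm \<Rightarrow> ('c \<Rightarrow> 'm \<Rightarrow> 'f::real_normed_field) \<Rightarrow> 'c set \<Rightarrow> ('m \<Rightarrow> 'f) set"
  where "stalk_counit n A x \<epsilon> =
    stalk_to_germ n A x \<circ> stalk_map n A x (regular_module (Cc_ring n A)) \<epsilon>"

end

(* The canonical map tau : C \<otimes>\<^sub>R C \<rightarrow> C\<^sub>x \<otimes>\<^sub>S C\<^sub>x with S = (C\<^sup>\<infinity>\<^sub>M)\<^sub>x kills N\<^sub>x(C \<otimes>\<^sub>R C), because f acts on the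
   target through its germ. Hence \<Delta>\<^sub>x [c] = tau (\<Delta> c) and \<epsilon>\<^sub>x [c] = germ of \<epsilon> c, and every coalgebra
   identity for the stalks becomes an equality of two additive maps on C \<otimes>\<^sub>R C, which is checked on
   pure tensors. The injectivity of tau on (C \<otimes>\<^sub>R C)\<^sub>x plays no role.

   The only analysis needed is that every germ at x is the germ of a compactly supported function,
   i.e. bump functions. Here b = h(u) with u the sum of squares of the centred coordinates of one
   chart; the coordinates are smooth in every other chart by the atlas axiom, so only the chain rule
   for the one-variable function h is needed. *)
theory Submission
  imports Defs
begin

section \<open>Bump functions\<close>

text \<open>If M is not compact, R has no identity. Its place is taken by the elements e of R with
  germ 1 at x: multiplication by e changes neither a germ at x nor a class in C_x, and two elements
  of R have the same germ exactly if they agree after multiplication by some such e. This presents S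
  as R / N_x(R) and makes the stalk part of the proof pure algebra. C and C_x are modules over
  different rings, so \<tau> is not a linear map over one ring. It is treated as an additive map
  that is semilinear along the map sending f to its germ; for this reason maps on tensor products
  are compared in the additive monoids only. The definitions choose a representative or take a union
  over all of them. For each construction some lemma evaluates it on generators
  (\<open>germ_mult\<close>, \<open>Cx_smult\<close>, \<open>stalk_map_q\<close>,
  \<open>tensor_lift_pure\<close>, \<open>stalk_tensor_q\<close>), and later arguments work with
  these evaluations instead of the choices.\<close>

lemma Euclidean_space_eq_top_of_set:
  "Euclidean_space n = top_of_set (topspace (Euclidean_space n))"
  by (simp add: Euclidean_space_def euclidean_product_topology)

section \<open>C^k functions on subsets of R^n\<close>

lemma continuous_map_subtopology_Euclidean_space:
  assumes "U \<subseteq> topspace (Euclidean_space n)"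
  shows "continuous_map (subtopology (Euclidean_space n) U) euclidean f \<longleftrightarrow> continuous_on U f"
proof -
  have "subtopology (Euclidean_space n) U = top_of_set U"
    using assms
    by (subst Euclidean_space_eq_top_of_set) (simp add: subtopology_subtopology Int_absorb1)
  then show ?thesis by simp
qed

lemma continuous_on_if_C_on:
  assumes "C_on k n U f" "U \<subseteq> topspace (Euclidean_space n)"
  shows "continuous_on U f"
  using assms continuous_map_subtopology_Euclidean_space by (cases k) auto

lemma C_on_SucI:
  assumes "continuous_on U f" "U \<subseteq> topspace (Euclidean_space n)"
    and "\<And>i v. i < n \<Longrightarrow> v \<in> U \<Longrightarrow> ((\<lambda>t. f (v(i := t))) has_vector_derivative f' i v) (at (v i))"
    and "\<And>i. i < n \<Longrightarrow> C_on k n U (f' i)"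
  shows "C_on (Suc k) n U f"
  unfolding C_on.simps continuous_map_subtopology_Euclidean_space[OF assms(2)]
  using assms by blast

lemma C_on_SucE:
  assumes "C_on (Suc k) n U f"
  obtains f' where
    "\<And>i v. i < n \<Longrightarrow> v \<in> U \<Longrightarrow> ((\<lambda>t. f (v(i := t))) has_vector_derivative f' i v) (at (v i))"
    "\<And>i. i < n \<Longrightarrow> C_on k n U (f' i)"
  using assms by auto

text \<open>The map sending t to \<open>v(i := t)\<close> is continuous for the product topology
  and, as i < n, leaves the coordinates from n on at 0. Consequently a partial derivative at a point
  of an open U depends only on the values in U.\<close>

lemma eventually_slice_in_open:
  assumes U: "openin (Euclidean_space n) U" and "v \<in> U" "i < n"
  shows "eventually (\<lambda>t. v(i := t) \<in> U) (nhds (v i))"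
proof -
  obtain T where T: "open T" "U = topspace (Euclidean_space n) \<inter> T"
    using U by (subst (asm) Euclidean_space_eq_top_of_set) (auto simp: openin_open)
  have cont: "continuous_on UNIV (\<lambda>t. v(i := t))"
  proof (intro continuous_on_coordinatewise_then_product)
    show "continuous_on UNIV (\<lambda>t. (v(i := t)) j)" for j
      by (cases "j = i") auto
  qed
  have "open ((\<lambda>t. v(i := t)) -` T)"
    using continuous_on_open_vimage[OF open_UNIV] cont T(1) by (metis Int_UNIV_right)
  moreover have "v i \<in> (\<lambda>t. v(i := t)) -` T"
    using assms T by auto
  ultimately have "eventually (\<lambda>t. t \<in> (\<lambda>t. v(i := t)) -` T) (nhds (v i))"
    by (rule eventually_nhds_in_open)
  then show ?thesis
    by (rule eventually_mono) (use assms T in \<open>auto simp: topspace_Euclidean_space\<close>)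
qed

lemma has_vector_derivative_slice_cong:
  assumes U: "openin (Euclidean_space n) U" and "v \<in> U" "i < n"
    and eq: "\<And>w. w \<in> U \<Longrightarrow> f w = g w"
    and f: "((\<lambda>t. f (v(i := t))) has_vector_derivative d) (at (v i))"
  shows "((\<lambda>t. g (v(i := t))) has_vector_derivative d) (at (v i))"
proof -
  have "eventually (\<lambda>t. f (v(i := t)) = g (v(i := t))) (at (v i))"
    using eventually_nhds_conv_at eventually_mono[OF eventually_slice_in_open[OF assms(1-3)] eq] by blast
  with f assms(2) show ?thesis
    unfolding has_vector_derivative_def
    by (elim has_derivative_transform_eventually) (simp_all add: eq)
qed

text \<open>Functions are total, but only their values on U are controlled. Openness of U makes the
  partial derivatives of f and g at points of U agree as well, so the derivatives of f serve for
  g.\<close>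

lemma C_on_cong:
  assumes "openin (Euclidean_space n) U" "\<And>w. w \<in> U \<Longrightarrow> f w = g w" "C_on k n U f"
  shows "C_on k n U g"
proof (cases k)
  case 0
  have UE: "U \<subseteq> topspace (Euclidean_space n)" using assms(1) by (rule openin_subset)
  from 0 show ?thesis
    using assms(2,3) by (simp add: continuous_map_subtopology_Euclidean_space[OF UE] cong: continuous_on_cong)
next
  case (Suc k')
  have UE: "U \<subseteq> topspace (Euclidean_space n)" using assms(1) by (rule openin_subset)
  from assms(3) Suc obtain f' where f': "\<And>i v. i < n \<Longrightarrow> v \<in> U \<Longrightarrow>
      ((\<lambda>t. f (v(i := t))) has_vector_derivative f' i v) (at (v i))"
     "\<And>i. i < n \<Longrightarrow> C_on k' n U (f' i)" "continuous_on U f"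
    by (auto simp: continuous_map_subtopology_Euclidean_space[OF UE])
  have "continuous_on U g"
    using f'(3) assms(2) by (simp cong: continuous_on_cong)
  then show ?thesis
    unfolding Suc
    by (rule C_on_SucI[OF _ UE has_vector_derivative_slice_cong[OF assms(1) _ _ assms(2) f'(1)] f'(2)])
qed

lemma C_on_SucD: "C_on (Suc k) n U f \<Longrightarrow> C_on k n U f"
proof (induction k arbitrary: f)
  case (Suc k)
  obtain f' where f': "\<And>i v. i < n \<Longrightarrow> v \<in> U \<Longrightarrow> ((\<lambda>t. f (v(i := t))) has_vector_derivative f' i v) (at (v i))"
    "\<And>i. i < n \<Longrightarrow> C_on (Suc k) n U (f' i)"
    using Suc.prems by (rule C_on_SucE) blast
  have "continuous_map (subtopology (Euclidean_space n) U) euclidean f"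
    using Suc.prems by (simp only: C_on.simps(2))
  moreover have "C_on k n U (f' i)" if "i < n" for i
    by (rule Suc.IH[OF f'(2)[OF that]])
  ultimately show ?case
    unfolding C_on.simps(2) by (intro conjI exI[of _ f'] allI impI ballI f'(1)) auto
qed simp

text \<open>The derivatives at v are those of the total function along coordinate lines, so passing
  from U to U' does not affect them.\<close>

lemma C_on_subset:
  assumes "C_on k n U f" "U' \<subseteq> U" "U \<subseteq> topspace (Euclidean_space n)"
  shows "C_on k n U' f"
  using assms
proof (induction k arbitrary: f)
  case 0
  then show ?case
    by (simp add: continuous_map_subtopology_Euclidean_space) (meson continuous_on_subset)
next
  case (Suc k)
  obtain f' where f': "\<And>i v. i < n \<Longrightarrow> v \<in> U \<Longrightarrow> ((\<lambda>t. f (v(i := t))) has_vector_derivative f' i v) (at (v i))"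
    "\<And>i. i < n \<Longrightarrow> C_on k n U (f' i)"
    using Suc.prems(1) by (rule C_on_SucE) blast
  have "continuous_on U' f"
    using continuous_on_if_C_on[OF Suc.prems(1,3)] Suc.prems(2) by (rule continuous_on_subset)
  moreover have "U' \<subseteq> topspace (Euclidean_space n)" using Suc.prems by blast
  ultimately show ?case
    by (rule C_on_SucI[OF _ _ f'(1) Suc.IH[OF f'(2) Suc.prems(2,3)]]) (use Suc.prems(2) in auto)
qed

lemma continuous_on_local:
  assumes "\<And>v. v \<in> U \<Longrightarrow> \<exists>U'. openin (Euclidean_space n) U' \<and> v \<in> U' \<and> continuous_on U' f"
  shows "continuous_on U f"
  unfolding continuous_on_eq_continuous_within
proof
  fix v assume v: "v \<in> U"
  have UE: "U \<subseteq> topspace (Euclidean_space n)"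
    using assms openin_subset by blast
  obtain U' where U': "openin (Euclidean_space n) U'" "v \<in> U'" "continuous_on U' f"
    using assms[OF v] by auto
  from U'(1) obtain T where T: "open T" "U' = topspace (Euclidean_space n) \<inter> T"
    by (subst (asm) Euclidean_space_eq_top_of_set) (auto simp: openin_open)
  have "continuous_on (U \<inter> T) f"
    using U'(3) by (rule continuous_on_subset) (use T UE in auto)
  then have "continuous (at v within U \<inter> T) f"
    using v U' T by (auto simp: continuous_on_eq_continuous_within)
  moreover have "at v within U \<inter> T = at v within U"
    by (rule at_within_nhd[of v T]) (use U' T in auto)
  ultimately show "continuous (at v within U) f" by simp
qed

text \<open>Gluing principle: a function made of pieces, such as a bump function continued by 0, is
  of class C^k once it is so near every point.\<close>

lemma C_on_local:
  assumes "\<And>v. v \<in> U \<Longrightarrow> \<exists>U'. openin (Euclidean_space n) U' \<and> v \<in> U' \<and> C_on k n U' f"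
  shows "C_on k n U f"
proof -
  have UE: "U \<subseteq> topspace (Euclidean_space n)"
    using assms openin_subset by blast
  have cont: "continuous_on U f"
    by (rule continuous_on_local[of _ n]) (use assms continuous_on_if_C_on openin_subset in metis)
  from assms cont show ?thesis
  proof (induction k arbitrary: f)
    case 0
    then show ?case
      by (simp add: continuous_map_subtopology_Euclidean_space[OF UE])
  next
    case (Suc k)
    \<comment> \<open>The hypothesis supplies unrelated derivatives on each neighbourhood.
      \<open>vector_derivative\<close> is one choice for all of U, and by uniqueness of derivatives
      it agrees with each local one.\<close>
    define f' where "f' = (\<lambda>i v. vector_derivative (\<lambda>t. f (v(i := t))) (at (v i)))"
    have loc: "\<exists>U'. openin (Euclidean_space n) U' \<and> v \<in> U' \<and> (\<forall>i<n. C_on k n U' (f' i) \<and>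
        (\<forall>v\<in>U'. ((\<lambda>t. f (v(i := t))) has_vector_derivative f' i v) (at (v i))))" if v: "v \<in> U" for v
    proof -
      from Suc.prems(1)[OF v] obtain U' g where U': "openin (Euclidean_space n) U'" "v \<in> U'"
        and g: "\<And>i v. i < n \<Longrightarrow> v \<in> U' \<Longrightarrow> ((\<lambda>t. f (v(i := t))) has_vector_derivative g i v) (at (v i))"
          "\<And>i. i < n \<Longrightarrow> C_on k n U' (g i)"
        by auto
      have eq: "f' i v = g i v" if "i < n" "v \<in> U'" for i v
        unfolding f'_def by (rule vector_derivative_at[OF g(1)[OF that]])
      have "C_on k n U' (f' i)" if "i < n" for i
        by (rule C_on_cong[OF U'(1) _ g(2)[OF that]]) (simp add: eq that)
      with U' g eq show ?thesis by (intro exI[of _ U']) auto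
    qed
    have "C_on k n U (f' i)" if i: "i < n" for i
    proof (rule Suc.IH)
      show 1: "\<exists>U'. openin (Euclidean_space n) U' \<and> v \<in> U' \<and> C_on k n U' (f' i)" if "v \<in> U" for v
        using loc[OF that] i by blast
      show "continuous_on U (f' i)"
        by (rule continuous_on_local[of _ n]) (use 1 continuous_on_if_C_on openin_subset in metis)
    qed
    moreover have "((\<lambda>t. f (v(i := t))) has_vector_derivative f' i v) (at (v i))"
      if "i < n" "v \<in> U" for i v
      using loc[OF that(2)] that(1) by blast
    ultimately show ?case
      using Suc.prems(2) by (auto simp: continuous_map_subtopology_Euclidean_space[OF UE])
  qed
qed

context
  fixes n :: nat and U :: "(nat \<Rightarrow> real) set"
  assumes UE: "U \<subseteq> topspace (Euclidean_space n)"
begin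

lemma C_on_const: "C_on k n U (\<lambda>v. c)"
proof (induction k arbitrary: c)
  case (Suc k)
  then show ?case
    by (intro C_on_SucI[where f' = "\<lambda>_ _. 0"] UE) auto
qed simp

text \<open>Covers negation, and \<open>of_real\<close>, through which real bump functions enter the
  scalars \<open>'f\<close>.\<close>

lemma C_on_bounded_linear:
  assumes h: "bounded_linear h" and "C_on k n U f"
  shows "C_on k n U (\<lambda>v. h (f v))"
  using assms(2)
proof (induction k arbitrary: f)
  case 0
  then show ?case
    using bounded_linear.continuous_on[OF h]
    by (simp add: continuous_map_subtopology_Euclidean_space[OF UE])
next
  case (Suc k)
  obtain f' where "\<And>i v. i < n \<Longrightarrow> v \<in> U \<Longrightarrow> ((\<lambda>t. f (v(i := t))) has_vector_derivative f' i v) (at (v i))"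
    "\<And>i. i < n \<Longrightarrow> C_on k n U (f' i)"
    using Suc.prems by (rule C_on_SucE) blast
  note f' = this
  show ?case
    by (rule C_on_SucI[where f' = "\<lambda>i v. h (f' i v)",
          OF bounded_linear.continuous_on[OF h continuous_on_if_C_on[OF Suc.prems UE]] UE])
      (assumption | rule bounded_linear.has_vector_derivative[OF h f'(1)] Suc.IH[OF f'(2)])+
qed

lemma C_on_add:
  assumes "C_on k n U f" "C_on k n U g"
  shows "C_on k n U (\<lambda>v. f v + g v)"
  using assms
proof (induction k arbitrary: f g)
  case 0
  then show ?case
    by (simp add: continuous_map_subtopology_Euclidean_space[OF UE] continuous_on_add)
next
  case (Suc k)
  obtain f' where f': "\<And>i v. i < n \<Longrightarrow> v \<in> U \<Longrightarrow> ((\<lambda>t. f (v(i := t))) has_vector_derivative f' i v) (at (v i))"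
    "\<And>i. i < n \<Longrightarrow> C_on k n U (f' i)"
    using Suc.prems(1) by (rule C_on_SucE) blast
  obtain g' where g': "\<And>i v. i < n \<Longrightarrow> v \<in> U \<Longrightarrow> ((\<lambda>t. g (v(i := t))) has_vector_derivative g' i v) (at (v i))"
    "\<And>i. i < n \<Longrightarrow> C_on k n U (g' i)"
    using Suc.prems(2) by (rule C_on_SucE) blast
  show ?case
    by (rule C_on_SucI[where f' = "\<lambda>i v. f' i v + g' i v",
          OF continuous_on_add[OF continuous_on_if_C_on[OF Suc.prems(1) UE]
            continuous_on_if_C_on[OF Suc.prems(2) UE]] UE])
      (assumption | rule has_vector_derivative_add[OF f'(1) g'(1)] Suc.IH[OF f'(2) g'(2)])+
qed

text \<open>Product rule. Both f and g occur undifferentiated in the derivative, so the induction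
  hypothesis is applied to them one order lower, which \<open>C_on_SucD\<close> permits.\<close>

lemma C_on_mult:
  fixes f g :: "(nat \<Rightarrow> real) \<Rightarrow> 'a::real_normed_field"
  assumes "C_on k n U f" "C_on k n U g"
  shows "C_on k n U (\<lambda>v. f v * g v)"
  using assms
proof (induction k arbitrary: f g)
  case 0
  then show ?case
    by (simp add: continuous_map_subtopology_Euclidean_space[OF UE] continuous_on_mult)
next
  case (Suc k)
  obtain f' where f': "\<And>i v. i < n \<Longrightarrow> v \<in> U \<Longrightarrow> ((\<lambda>t. f (v(i := t))) has_vector_derivative f' i v) (at (v i))"
    "\<And>i. i < n \<Longrightarrow> C_on k n U (f' i)"
    using Suc.prems(1) by (rule C_on_SucE) blast
  obtain g' where g': "\<And>i v. i < n \<Longrightarrow> v \<in> U \<Longrightarrow> ((\<lambda>t. g (v(i := t))) has_vector_derivative g' i v) (at (v i))"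
    "\<And>i. i < n \<Longrightarrow> C_on k n U (g' i)"
    using Suc.prems(2) by (rule C_on_SucE) blast
  have "((\<lambda>t. f (v(i := t)) * g (v(i := t))) has_vector_derivative f v * g' i v + f' i v * g v) (at (v i))"
    if "i < n" "v \<in> U" for i v
    using has_vector_derivative_mult[OF f'(1)[OF that] g'(1)[OF that]] by simp
  then show ?case
    by (rule C_on_SucI[where f' = "\<lambda>i v. f v * g' i v + f' i v * g v",
          OF continuous_on_mult[OF continuous_on_if_C_on[OF Suc.prems(1) UE]
            continuous_on_if_C_on[OF Suc.prems(2) UE]] UE])
      (assumption | rule C_on_add[OF Suc.IH[OF C_on_SucD[OF Suc.prems(1)] g'(2)]
          Suc.IH[OF f'(2) C_on_SucD[OF Suc.prems(2)]]])+
qed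

lemma C_on_diff:
  fixes f g :: "(nat \<Rightarrow> real) \<Rightarrow> 'a::real_normed_vector"
  assumes "C_on k n U f" "C_on k n U g"
  shows "C_on k n U (\<lambda>v. f v - g v)"
  using C_on_add[OF assms(1) C_on_bounded_linear[OF bounded_linear_minus[OF bounded_linear_ident] assms(2)]]
  by simp

lemma C_on_sum:
  assumes "\<And>j. j \<in> J \<Longrightarrow> C_on k n U (f j)"
  shows "C_on k n U (\<lambda>v. \<Sum>j\<in>J. f j v)"
  using assms by (induction J rule: infinite_finite_induct) (auto intro: C_on_const C_on_add)

end

text \<open>Closed under differentiation up to linear combinations, so that smoothness of the composition
  with a smooth function is one induction for all \<open>m\<close> simultaneously.\<close>
definition flat_exp :: "nat \<Rightarrow> real \<Rightarrow> real"
  where "flat_exp m t = (if t > 0 then (1 / t) ^ m * exp (- 1 / t) else 0)"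

text \<open>With s = 1/t the limit from the right is that of s^m / exp s at infinity; on the left
  the function vanishes.\<close>

lemma flat_exp_tendsto_0: "(flat_exp m \<longlongrightarrow> 0) (at 0)"
proof -
  have "((\<lambda>s. s ^ m / exp s) \<longlongrightarrow> (0::real)) at_top"
    by (rule tendsto_power_div_exp_0)
  then have "((\<lambda>t. (1 / t) ^ m / exp (1 / t)) \<longlongrightarrow> (0::real)) (at_right 0)"
    by (rule filterlim_compose) (simp add: filterlim_inverse_at_top_right divide_inverse)
  then have "(flat_exp m \<longlongrightarrow> 0) (at_right 0)"
    by (rule Lim_transform_eventually)
      (auto simp: eventually_at_filter flat_exp_def exp_minus divide_inverse)
  moreover have "(flat_exp m \<longlongrightarrow> 0) (at_left 0)"
    by (rule tendsto_eventually) (auto simp: eventually_at_filter flat_exp_def)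
  ultimately show ?thesis
    by (simp add: filterlim_at_split)
qed

text \<open>At 0 the difference quotient of \<open>flat_exp m\<close> is
  \<open>flat_exp (Suc m)\<close>, which tends to 0, and both terms of the formula are 0 there.
  Elsewhere the function agrees near t with an elementary expression or with 0.\<close>

lemma flat_exp_has_derivative:
  "(flat_exp m has_real_derivative flat_exp (m + 2) t - of_nat m * flat_exp (Suc m) t) (at t)"
proof (cases "t = 0")
  case True
  have "((\<lambda>h. flat_exp m h / h) \<longlongrightarrow> 0) (at 0)"
    by (rule Lim_transform_eventually[OF flat_exp_tendsto_0[of "Suc m"]])
      (auto simp: flat_exp_def eventually_at intro!: exI[of _ 1])
  then show ?thesis
    using True by (simp add: DERIV_def flat_exp_def)
next
  case False
  show ?thesis
  proof (cases "t > 0")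
    case True
    have "((\<lambda>t. (1 / t) ^ m * exp (- 1 / t)) has_real_derivative
        flat_exp (m + 2) t - of_nat m * flat_exp (Suc m) t) (at t)"
    proof -
      have "((\<lambda>t. (1 / t) ^ m * exp (- 1 / t)) has_real_derivative
          (1 / t) ^ m * (exp (- 1 / t) * (1 / t ^ 2)) +
          of_nat m * (1 / t) ^ (m - Suc 0) * (- 1 / t ^ 2) * exp (- 1 / t)) (at t)"
        using True by (auto intro!: derivative_eq_intros simp: power2_eq_square)
      \<comment> \<open>For m = 0 the truncated exponent is harmless, since the factor
        \<open>of_nat m\<close> makes both sides 0.\<close>
      moreover have "of_nat m * (1 / t) ^ (m - Suc 0) * (- 1 / t ^ 2) = - (of_nat m * (1 / t) ^ Suc m)"
        by (cases m) (simp_all add: power2_eq_square)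
      ultimately show ?thesis
        by (simp only:) (use True in \<open>simp add: flat_exp_def power_add power_divide power2_eq_square algebra_simps\<close>)
    qed
    then show ?thesis
      by (rule has_field_derivative_transform_within_open[of _ _ _ "{0<..}"])
        (use True in \<open>auto simp: flat_exp_def\<close>)
  next
    case nonpos: False
    have "((\<lambda>t. 0) has_real_derivative 0) (at t)" by simp
    then have "(flat_exp m has_real_derivative 0) (at t)"
      by (rule has_field_derivative_transform_within_open[of _ _ _ "{..<0}"])
        (use False nonpos in \<open>auto simp: flat_exp_def\<close>)
    with nonpos show ?thesis by (simp add: flat_exp_def)
  qed
qed

lemma C_on_flat_exp:
  assumes UE: "U \<subseteq> topspace (Euclidean_space n)" and "C_on k n U u"
  shows "C_on k n U (\<lambda>v. flat_exp m (u v))"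
  using assms(2)
proof (induction k arbitrary: m)
  case 0
  have "continuous_on UNIV (flat_exp m)"
    by (rule continuous_at_imp_continuous_on) (simp add: DERIV_isCont[OF flat_exp_has_derivative])
  then have "continuous_on U (\<lambda>v. flat_exp m (u v))"
    by (rule continuous_on_compose2[OF _ continuous_on_if_C_on[OF 0 UE]]) simp
  then show ?case
    by (simp add: continuous_map_subtopology_Euclidean_space[OF UE])
next
  case (Suc k)
  obtain u' where u': "\<And>i v. i < n \<Longrightarrow> v \<in> U \<Longrightarrow> ((\<lambda>t. u (v(i := t))) has_vector_derivative u' i v) (at (v i))"
    "\<And>i. i < n \<Longrightarrow> C_on k n U (u' i)"
    using Suc.prems by (rule C_on_SucE) blast
  note IH = Suc.IH[OF C_on_SucD[OF Suc.prems]]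
  show ?case
  proof (rule C_on_SucI[where f' = "\<lambda>i v. (flat_exp (m + 2) (u v) - of_nat m * flat_exp (Suc m) (u v)) * u' i v"])
    show "continuous_on U (\<lambda>v. flat_exp m (u v))"
      by (rule continuous_on_if_C_on[OF IH UE])
    fix i v assume iv: "i < n" "v \<in> U"
    have "((\<lambda>t. u (v(i := t))) has_real_derivative u' i v) (at (v i))"
      using u'(1)[OF iv] by (simp add: has_real_derivative_iff_has_vector_derivative)
    from DERIV_chain2[where f = "flat_exp m" and g = "\<lambda>t. u (v(i := t))", OF flat_exp_has_derivative this]
    show "((\<lambda>t. flat_exp m (u (v(i := t)))) has_vector_derivative
        (flat_exp (m + 2) (u v) - of_nat m * flat_exp (Suc m) (u v)) * u' i v) (at (v i))"
      by (simp add: has_real_derivative_iff_has_vector_derivative)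
  next
    show "C_on k n U (\<lambda>v. (flat_exp (m + 2) (u v) - of_nat m * flat_exp (Suc m) (u v)) * u' i v)" if "i < n" for i
      by (rule C_on_mult[OF UE C_on_diff[OF UE IH[of "m + 2"] C_on_mult[OF UE C_on_const[OF UE] IH[of "Suc m"]]] u'(2)[OF that]])
  qed (rule UE)
qed

text \<open>The argument of the outer \<^term>\<open>flat_exp 0\<close> is constant for \<open>s \<le> r\<close> and nonpositive for \<open>2 * r \<le> s\<close>;
  nesting avoids a quotient rule for smooth functions.\<close>
definition cutoff :: "real \<Rightarrow> real \<Rightarrow> real"
  where "cutoff r s = flat_exp 0 (flat_exp 0 r - flat_exp 0 (s - r)) / flat_exp 0 (flat_exp 0 r)"

lemma cutoff_eq_1: "r > 0 \<Longrightarrow> s \<le> r \<Longrightarrow> cutoff r s = 1"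
  by (simp add: cutoff_def flat_exp_def)

text \<open>From r \<le> s - r follows 1 / (s - r) \<le> 1 / r, so the inner difference of
  exponentials is not positive and the outer \<open>flat_exp 0\<close> vanishes.\<close>

lemma cutoff_eq_0: "r > 0 \<Longrightarrow> 2 * r \<le> s \<Longrightarrow> cutoff r s = 0"
  using frac_le[of 1 1 r "s - r"] by (auto simp: cutoff_def flat_exp_def)

lemma C_on_cutoff:
  assumes UE: "U \<subseteq> topspace (Euclidean_space n)" and "C_on k n U u"
  shows "C_on k n U (\<lambda>v. cutoff r (u v))"
proof -
  have "C_on k n U (\<lambda>v. inverse (flat_exp 0 (flat_exp 0 r)) *
      flat_exp 0 (flat_exp 0 r - flat_exp 0 (u v - r)))"
    by (rule C_on_mult[OF UE C_on_const[OF UE] C_on_flat_exp[OF UE C_on_diff[OF UE C_on_const[OF UE]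
            C_on_flat_exp[OF UE C_on_diff[OF UE assms(2) C_on_const[OF UE]]]]]])
  then show ?thesis by (simp add: cutoff_def divide_inverse mult.commute)
qed

section \<open>Charts and smooth functions on the manifold\<close>

lemma is_chartD:
  assumes "is_chart n (U, \<phi>)"
  shows "open U" "inj_on \<phi> U" "continuous_on U \<phi>" "continuous_on (\<phi> ` U) (inv_into U \<phi>)"
    and "\<And>W. open W \<Longrightarrow> openin (Euclidean_space n) (\<phi> ` (U \<inter> W))"
proof -
  from assms obtain V where U: "open U" and V: "openin (Euclidean_space n) V"
    and h: "homeomorphic_map (top_of_set U) (subtopology (Euclidean_space n) V) \<phi>"
    by (auto simp: is_chart_def)
  show "open U" by (rule U)
  have VE: "V \<subseteq> topspace (Euclidean_space n)"
    using V by (rule openin_subset)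
  have eq: "subtopology (Euclidean_space n) V = top_of_set V"
    using VE by (subst Euclidean_space_eq_top_of_set) (simp add: subtopology_subtopology Int_absorb1)
  note h' = h[unfolded eq]
  have im: "\<phi> ` U = V"
    using homeomorphic_imp_surjective_map[OF h'] by simp
  show inj: "inj_on \<phi> U"
    using homeomorphic_imp_injective_map[OF h'] by simp
  show "continuous_on U \<phi>"
    using homeomorphic_imp_continuous_map[OF h'] by simp
  obtain \<psi> where \<psi>: "homeomorphic_maps (top_of_set U) (top_of_set V) \<phi> \<psi>"
    using h' homeomorphic_map_maps by blast
  have "continuous_on V \<psi>"
    using \<psi> by (simp add: homeomorphic_maps_def)
  \<comment> \<open>\<open>smooth_fun\<close> is phrased with \<open>inv_into\<close>; by
    injectivity it coincides on V with the continuous inverse that the homeomorphism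
    provides.\<close>
  moreover have "inv_into U \<phi> v = \<psi> v" if "v \<in> V" for v
  proof (rule inv_into_f_eq[OF inj])
    show "\<psi> v \<in> U" "\<phi> (\<psi> v) = v"
      using \<psi> that by (auto simp: homeomorphic_maps_def continuous_map_def)
  qed
  ultimately show "continuous_on (\<phi> ` U) (inv_into U \<phi>)"
    unfolding im by (simp cong: continuous_on_cong)
  show "openin (Euclidean_space n) (\<phi> ` (U \<inter> W))" if "open W" for W
  proof -
    have "openin (top_of_set U) (U \<inter> W)"
      using that by (simp add: openin_open_Int)
    then have "openin (subtopology (Euclidean_space n) V) (\<phi> ` (U \<inter> W))"
      using homeomorphic_imp_open_map[OF h] by (simp add: open_map_def)
    then show ?thesis
      using V openin_open_subtopology by blast
  qed
qed

lemma smooth_atlas_chart: "smooth_atlas n A \<Longrightarrow> (U, \<phi>) \<in> A \<Longrightarrow> is_chart n (U, \<phi>)"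
  by (auto simp: smooth_atlas_def)

lemma smooth_atlas_image_subset:
  "smooth_atlas n A \<Longrightarrow> (U, \<phi>) \<in> A \<Longrightarrow> \<phi> ` (U \<inter> W) \<subseteq> topspace (Euclidean_space n)"
  using is_chartD(5)[of n U \<phi> UNIV, OF smooth_atlas_chart] openin_subset by fastforce

lemma smooth_fun_subset:
  assumes "smooth_atlas n A" "smooth_fun n A W f" "W' \<subseteq> W"
  shows "smooth_fun n A W' f"
  unfolding smooth_fun_def smooth_on_Rn_def
proof (clarify)
  fix U \<phi> k assume c: "(U, \<phi>) \<in> A"
  have "C_on k n (\<phi> ` (U \<inter> W)) (\<lambda>v. f (inv_into U \<phi> v))"
    using assms(2) c by (auto simp: smooth_fun_def smooth_on_Rn_def)
  then show "C_on k n (\<phi> ` (U \<inter> W')) (\<lambda>v. f (inv_into U \<phi> v))"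
    by (rule C_on_subset) (use assms(3) smooth_atlas_image_subset[OF assms(1) c] in auto)
qed

text \<open>Charts map open sets to open subsets of R^n, so this is \<open>C_on_local\<close> read
  in each chart.\<close>

lemma smooth_fun_local:
  assumes A: "smooth_atlas n A" and W: "open W"
    and loc: "\<And>y. y \<in> W \<Longrightarrow> \<exists>W'. open W' \<and> y \<in> W' \<and> smooth_fun n A (W \<inter> W') f"
  shows "smooth_fun n A W f"
  unfolding smooth_fun_def smooth_on_Rn_def
proof (clarify)
  fix U \<phi> k assume c: "(U, \<phi>) \<in> A"
  show "C_on k n (\<phi> ` (U \<inter> W)) (\<lambda>v. f (inv_into U \<phi> v))"
  proof (rule C_on_local)
    fix v assume "v \<in> \<phi> ` (U \<inter> W)"
    then obtain y where y: "y \<in> U" "y \<in> W" "v = \<phi> y" by auto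
    obtain W' where W': "open W'" "y \<in> W'" "smooth_fun n A (W \<inter> W') f"
      using loc[OF y(2)] by auto
    have "C_on k n (\<phi> ` (U \<inter> (W \<inter> W'))) (\<lambda>v. f (inv_into U \<phi> v))"
      using W'(3) c by (auto simp: smooth_fun_def smooth_on_Rn_def)
    moreover have "openin (Euclidean_space n) (\<phi> ` (U \<inter> (W \<inter> W')))"
      by (rule is_chartD(5)[OF smooth_atlas_chart[OF A c]]) (use W W' in auto)
    ultimately show "\<exists>U'. openin (Euclidean_space n) U' \<and> v \<in> U' \<and> C_on k n U' (\<lambda>v. f (inv_into U \<phi> v))"
      using y W'(2) by (intro exI[of _ "\<phi> ` (U \<inter> (W \<inter> W'))"]) auto
  qed
qed

lemma smooth_fun_cong:
  assumes A: "smooth_atlas n A" and W: "open W" and eq: "\<And>y. y \<in> W \<Longrightarrow> f y = g y"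
    and f: "smooth_fun n A W f"
  shows "smooth_fun n A W g"
  unfolding smooth_fun_def smooth_on_Rn_def
proof (clarify)
  fix U \<phi> k assume c: "(U, \<phi>) \<in> A"
  note chart = is_chartD[OF smooth_atlas_chart[OF A c]]
  show "C_on k n (\<phi> ` (U \<inter> W)) (\<lambda>v. g (inv_into U \<phi> v))"
  proof (rule C_on_cong[OF chart(5)[OF W]])
    show "C_on k n (\<phi> ` (U \<inter> W)) (\<lambda>v. f (inv_into U \<phi> v))"
      using f c by (auto simp: smooth_fun_def smooth_on_Rn_def)
    show "f (inv_into U \<phi> w) = g (inv_into U \<phi> w)" if "w \<in> \<phi> ` (U \<inter> W)" for w
      using that chart(2) eq by (auto simp: inv_into_f_f)
  qed
qed

lemma smooth_fun_const: "smooth_atlas n A \<Longrightarrow> smooth_fun n A W (\<lambda>y. c)"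
  unfolding smooth_fun_def smooth_on_Rn_def
  by (blast intro: C_on_const[OF smooth_atlas_image_subset])

lemma smooth_fun_mult:
  fixes f g :: "'m::t2_space \<Rightarrow> 'f::real_normed_field"
  assumes "smooth_atlas n A" "smooth_fun n A W f" "smooth_fun n A W g"
  shows "smooth_fun n A W (\<lambda>y. f y * g y)"
  unfolding smooth_fun_def smooth_on_Rn_def
proof clarify
  fix U \<phi> k assume c: "(U, \<phi>) \<in> A"
  show "C_on k n (\<phi> ` (U \<inter> W)) (\<lambda>v. f (inv_into U \<phi> v) * g (inv_into U \<phi> v))"
    using assms(2,3) c
    by (intro C_on_mult[OF smooth_atlas_image_subset[OF assms(1) c]]) (auto simp: smooth_fun_def smooth_on_Rn_def)
qed

lemma smooth_fun_of_real:
  assumes "smooth_atlas n A" "smooth_fun n A W f"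
  shows "smooth_fun n A W (\<lambda>y. of_real (f y) :: 'a::real_normed_field)"
  unfolding smooth_fun_def smooth_on_Rn_def
proof clarify
  fix U \<phi> k assume c: "(U, \<phi>) \<in> A"
  show "C_on k n (\<phi> ` (U \<inter> W)) (\<lambda>v. of_real (f (inv_into U \<phi> v)) :: 'a)"
    using assms(2) c
    by (intro C_on_bounded_linear[OF smooth_atlas_image_subset[OF assms(1) c] bounded_linear_of_real])
      (auto simp: smooth_fun_def smooth_on_Rn_def)
qed

text \<open>Only the first n coordinates may move, so one radius serves for all of them, although
  the ambient space consists of infinite sequences.\<close>

lemma open_in_product_contains_box:
  fixes c :: "nat \<Rightarrow> real"
  assumes T: "open T" "c \<in> T"
  obtains \<delta> where "\<delta> > 0"
    "\<And>v. (\<And>i. i < n \<Longrightarrow> \<bar>v i - c i\<bar> < \<delta>) \<Longrightarrow> (\<And>i. i \<ge> n \<Longrightarrow> v i = c i) \<Longrightarrow> v \<in> T"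
proof -
  have "openin (product_topology (\<lambda>i. euclidean) UNIV) T"
    using T by (simp add: open_fun_def)
  then obtain X where X: "c \<in> (\<Pi>\<^sub>E i\<in>UNIV. X i)" "\<And>i. open (X i)" "(\<Pi>\<^sub>E i\<in>UNIV. X i) \<subseteq> T"
    using product_topology_open_contains_basis[of "\<lambda>i. euclidean" UNIV T c] T(2) by auto
  have "\<exists>e>0. \<forall>t. \<bar>t - c i\<bar> < e \<longrightarrow> t \<in> X i" for i
  proof -
    have "c i \<in> X i" using X(1) by auto
    then obtain e where "e > 0" "ball (c i) e \<subseteq> X i"
      using X(2)[of i] open_contains_ball by blast
    then show ?thesis by (intro exI[of _ e]) (auto simp: subset_iff dist_real_def abs_minus_commute)
  qed
  then obtain e where e: "\<And>i. e i > 0" "\<And>i t. \<bar>t - c i\<bar> < e i \<Longrightarrow> t \<in> X i"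
    by metis
  \<comment> \<open>The inserted 1 keeps the minimum meaningful when n = 0.\<close>
  define \<delta> where "\<delta> = Min (insert 1 (e ` {..<n}))"
  have \<delta>: "\<delta> \<le> e i" if "i < n" for i
    unfolding \<delta>_def using that by (intro Min_le) auto
  show thesis
  proof
    show "\<delta> > 0" unfolding \<delta>_def using e(1) by (subst Min_gr_iff) auto
    fix v assume v: "\<And>i. i < n \<Longrightarrow> \<bar>v i - c i\<bar> < \<delta>" "\<And>i. i \<ge> n \<Longrightarrow> v i = c i"
    have "v i \<in> X i" for i
    proof (cases "i < n")
      case True
      then show ?thesis using v(1)[OF True] \<delta>[OF True] by (intro e(2)) simp
    next
      case False
      then show ?thesis using v(2)[of i] X(1) by auto
    qed
    then show "v \<in> T" using X(3) by auto
  qed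
qed

text \<open>The compact set K is named in the statement because \<open>Cc_ring_extension\<close>
  glues with 0 on the complement of K.\<close>

lemma bump_function_exists:
  fixes A :: "'m::t2_space chart set"
  assumes A: "smooth_atlas n A" and W: "open W" "x \<in> W"
  obtains b :: "'m \<Rightarrow> real" and K W' where "smooth_fun n A UNIV b" "compact K" "K \<subseteq> W"
    "\<And>y. y \<notin> K \<Longrightarrow> b y = 0" "open W'" "x \<in> W'" "\<And>y. y \<in> W' \<Longrightarrow> b y = 1"
proof -
  have "x \<in> \<Union> (fst ` A)" using A by (simp add: smooth_atlas_def)
  then obtain U \<phi> where c: "(U, \<phi>) \<in> A" and xU: "x \<in> U" by auto
  note chart = is_chartD[OF smooth_atlas_chart[OF A c]]
  have openin: "openin (Euclidean_space n) (\<phi> ` (U \<inter> W))"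
    by (rule chart(5)[OF W(1)])
  then obtain T where T: "open T" "\<phi> ` (U \<inter> W) = topspace (Euclidean_space n) \<inter> T"
    by (subst (asm) Euclidean_space_eq_top_of_set) (auto simp: openin_open)
  have E: "\<phi> y i = 0" if "y \<in> U" "i \<ge> n" for y i
    using smooth_atlas_image_subset[OF A c, of UNIV] that by (auto simp: topspace_Euclidean_space)
  have "\<phi> x \<in> T" using T xU W by auto
  then obtain \<delta> where \<delta>: "\<delta> > 0" "\<And>v. (\<And>i. i < n \<Longrightarrow> \<bar>v i - \<phi> x i\<bar> < \<delta>) \<Longrightarrow>
      (\<And>i. i \<ge> n \<Longrightarrow> v i = \<phi> x i) \<Longrightarrow> v \<in> T"
    using open_in_product_contains_box[OF T(1), of "\<phi> x" n] by metis
  \<comment> \<open>Half of \<delta>, so that the closed box of half-width d lies inside the open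
    box of half-width \<delta>.\<close>
  define d where "d = \<delta> / 2"
  have d: "d > 0" "d < \<delta>" using \<delta> by (auto simp: d_def)
  \<comment> \<open>Then 2 r = d^2, and 2 r is where \<open>cutoff r\<close> starts to vanish: u y <
    2 r keeps every coordinate of \<phi> y within distance d of that of \<phi> x.\<close>
  define r where "r = d\<^sup>2 / 2"
  have r: "r > 0" using d by (simp add: r_def)
  define u where "u = (\<lambda>y. \<Sum>i<n. (\<phi> y i - \<phi> x i) * (\<phi> y i - \<phi> x i))"
  \<comment> \<open>A closed box of R^n inside the space of all real sequences: the coordinates from
    n on are pinned to 0, and compactness is Tychonoff's theorem.\<close>
  define B where "B = (\<Pi>\<^sub>E i\<in>UNIV. if i < n then {\<phi> x i - d..\<phi> x i + d} else {0})"
  define K where "K = inv_into U \<phi> ` B"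
  have "compactin (product_topology (\<lambda>i. euclidean) UNIV) B"
    unfolding B_def by (subst compactin_PiE) auto
  then have "compact B" by (simp add: euclidean_product_topology)
  have BT: "v \<in> \<phi> ` (U \<inter> W)" if "v \<in> B" for v
  proof -
    have v: "v i \<in> (if i < n then {\<phi> x i - d..\<phi> x i + d} else {0})" for i
      using that by (auto simp: B_def PiE_iff)
    have "v \<in> T"
    proof (rule \<delta>(2))
      show "\<bar>v i - \<phi> x i\<bar> < \<delta>" if "i < n" for i
        using v[of i] that d by auto
      show "v i = \<phi> x i" if "i \<ge> n" for i
        using v[of i] that E[OF xU] by auto
    qed
    moreover have "v i = 0" if "i \<ge> n" for i
      using v[of i] that by auto
    ultimately show ?thesis
      unfolding T(2) by (auto simp: topspace_Euclidean_space)
  qed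
  have K: "compact K"
    unfolding K_def using \<open>compact B\<close>
    by (rule compact_continuous_image[rotated]) (rule continuous_on_subset[OF chart(4)], use BT in auto)
  have KUW: "K \<subseteq> U \<inter> W"
    unfolding K_def using BT chart(2) by (fastforce simp: inv_into_f_f)
  have inK: "y \<in> K" if "y \<in> U" "u y < 2 * r" for y
  proof -
    have "\<phi> y \<in> B"
      unfolding B_def PiE_UNIV_domain
    proof (rule Pi_I)
      fix i
      show "\<phi> y i \<in> (if i < n then {\<phi> x i - d..\<phi> x i + d} else {0})"
      proof (cases "i < n")
        case True
        have "(\<phi> y i - \<phi> x i)\<^sup>2 \<le> u y"
          unfolding u_def power2_eq_square using True by (intro member_le_sum) auto
        also have "\<dots> \<le> d\<^sup>2" using that(2) by (simp add: r_def)
        finally have "\<bar>\<phi> y i - \<phi> x i\<bar> \<le> d"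
          using d by (simp add: abs_le_square_iff[symmetric])
        then show ?thesis using True by auto
      qed (use E that in auto)
    qed
    then have "inv_into U \<phi> (\<phi> y) \<in> K" by (simp add: K_def)
    then show ?thesis using chart(2) that by (simp add: inv_into_f_f)
  qed
  \<comment> \<open>Outside U the chart carries no information. On U outside K one has u \<ge> 2 r,
    so b is already 0 there and the two cases fit together.\<close>
  define b where "b = (\<lambda>y. if y \<in> U then cutoff r (u y) else 0)"
  have b0: "b y = 0" if "y \<notin> K" for y
    using inK[of y] that r cutoff_eq_0[of r "u y"] by (force simp: b_def)
  have "smooth_fun n A U (\<lambda>y. cutoff r (u y))"
    unfolding smooth_fun_def smooth_on_Rn_def
  proof clarify
    fix V \<psi> k assume V: "(V, \<psi>) \<in> A"
    note UE = smooth_atlas_image_subset[OF A V, of U]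
    have co: "C_on k n (\<psi> ` (V \<inter> U)) (\<lambda>v. \<phi> (inv_into V \<psi> v) i)" if "i < n" for i
      using A V c that unfolding smooth_atlas_def smooth_on_Rn_def by blast
    have "C_on k n (\<psi> ` (V \<inter> U)) (\<lambda>v. u (inv_into V \<psi> v))"
      unfolding u_def by (intro C_on_sum[OF UE] C_on_mult[OF UE] C_on_diff[OF UE co C_on_const[OF UE]]) auto
    then show "C_on k n (\<psi> ` (V \<inter> U)) (\<lambda>v. cutoff r (u (inv_into V \<psi> v)))"
      by (rule C_on_cutoff[OF UE])
  qed
  then have bU: "smooth_fun n A U b"
    by (rule smooth_fun_cong[OF A chart(1), rotated]) (simp add: b_def)
  have clK: "open (- K)"
    using K by (simp add: compact_imp_closed open_Compl)
  have "smooth_fun n A (- K) (\<lambda>y. 0 :: real)"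
    by (rule smooth_fun_const[OF A])
  then have bK: "smooth_fun n A (- K) b"
    by (rule smooth_fun_cong[OF A clK, rotated]) (simp add: b0)
  \<comment> \<open>U and the complement of K cover M because K lies in U, and that complement is
    open because compact sets in a Hausdorff space are closed.\<close>
  have "smooth_fun n A UNIV b"
  proof (rule smooth_fun_local[OF A open_UNIV])
    fix y :: 'm
    show "\<exists>W'. open W' \<and> y \<in> W' \<and> smooth_fun n A (UNIV \<inter> W') b"
    proof (cases "y \<in> U")
      case True
      then show ?thesis using bU chart(1) by auto
    next
      case False
      then show ?thesis using bK clK KUW by (intro exI[of _ "- K"]) auto
    qed
  qed
  moreover have "continuous_on U (\<lambda>y. \<phi> y i)" for i
    using chart(3) by (rule continuous_on_product_then_coordinatewise)
  then have "continuous_on U u"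
    unfolding u_def by (intro continuous_on_sum continuous_on_mult continuous_on_diff continuous_on_const)
  then have "open (U \<inter> u -` {..<r})"
    by (rule continuous_open_preimage[OF _ chart(1) open_lessThan])
  moreover have "x \<in> U \<inter> u -` {..<r}"
    using xU r by (simp add: u_def)
  moreover have "b y = 1" if "y \<in> U \<inter> u -` {..<r}" for y
    using that r by (auto simp: b_def cutoff_eq_1)
  ultimately show thesis
    using that[of b K "U \<inter> u -` {..<r}"] K KUW b0 by blast
qed

text \<open>Outside W the function f is arbitrary, but multiplied by a bump function supported in a
  compact subset of W it can be continued by 0. The vanishing outside W is recorded because
  multipliers are wanted that erase everything outside a given neighbourhood of x.\<close>

lemma Cc_ring_extension:
  fixes A :: "'m::t2_space chart set" and f :: "'m \<Rightarrow> 'f::real_normed_field"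
  assumes A: "smooth_atlas n A" and W: "open W" "x \<in> W" and f: "smooth_fun n A W f"
  obtains g W' where "g \<in> carrier (Cc_ring n A)" "open W'" "x \<in> W'" "W' \<subseteq> W"
    "\<And>y. y \<in> W' \<Longrightarrow> g y = f y" "\<And>y. y \<notin> W \<Longrightarrow> g y = 0"
proof -
  obtain b :: "'m \<Rightarrow> real" and K W' where b: "smooth_fun n A UNIV b" "compact K" "K \<subseteq> W"
    "\<And>y. y \<notin> K \<Longrightarrow> b y = 0" "open W'" "x \<in> W'" "\<And>y. y \<in> W' \<Longrightarrow> b y = 1"
    using bump_function_exists[OF A W] by metis
  define g where "g = (\<lambda>y. of_real (b y) * f y)"
  have g0: "g y = 0" if "y \<notin> K" for y using b(4)[OF that] by (simp add: g_def)
  have gW: "smooth_fun n A W g"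
    unfolding g_def
    by (rule smooth_fun_mult[OF A smooth_fun_of_real[OF A smooth_fun_subset[OF A b(1)]] f]) simp
  have clK: "open (- K)"
    using b(2) by (simp add: compact_imp_closed open_Compl)
  have "smooth_fun n A (- K) (\<lambda>y. 0 :: 'f)"
    by (rule smooth_fun_const[OF A])
  then have gK: "smooth_fun n A (- K) g"
    by (rule smooth_fun_cong[OF A clK, rotated]) (simp add: g0)
  have "smooth_fun n A UNIV g"
  proof (rule smooth_fun_local[OF A open_UNIV])
    fix y :: 'm
    show "\<exists>W'. open W' \<and> y \<in> W' \<and> smooth_fun n A (UNIV \<inter> W') g"
    proof (cases "y \<in> W")
      case True
      then show ?thesis using gW W(1) by auto
    next
      case False
      then show ?thesis using gK clK b(3) by (intro exI[of _ "- K"]) auto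
    qed
  qed
  moreover have "closure {y. g y \<noteq> 0} \<subseteq> K"
    using g0 b(2) by (intro closure_minimal) (auto simp: compact_imp_closed)
  then have "compact (closure {y. g y \<noteq> 0})"
    using b(2) by (metis closed_closure compact_Int_closed inf.absorb_iff2)
  ultimately have "g \<in> carrier (Cc_ring n A)" by (simp add: Cc_ring_def)
  moreover have "open (W' \<inter> W)" "x \<in> W' \<inter> W" "W' \<inter> W \<subseteq> W" using b W by auto
  moreover have "g y = f y" if "y \<in> W' \<inter> W" for y using b(7) that by (simp add: g_def)
  ultimately show thesis using that g0 b(3) by blast
qed

section \<open>Tensor products\<close>

context locally_unitary_module
begin

lemma smult_r_zero: "a \<in> carrier R \<Longrightarrow> a \<odot>\<^bsub>M\<^esub> \<zero>\<^bsub>M\<^esub> = \<zero>\<^bsub>M\<^esub>"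
  using smult_r_distr[of a "\<zero>\<^bsub>M\<^esub>" "\<zero>\<^bsub>M\<^esub>"] smult_closed[of a "\<zero>\<^bsub>M\<^esub>"]
  by (simp add: M.add.r_cancel_one')

lemma smult_r_minus:
  assumes "a \<in> carrier R" "c \<in> carrier M"
  shows "a \<odot>\<^bsub>M\<^esub> (\<ominus>\<^bsub>M\<^esub> c) = \<ominus>\<^bsub>M\<^esub> (a \<odot>\<^bsub>M\<^esub> c)"
proof (rule M.minus_equality[symmetric])
  show "a \<odot>\<^bsub>M\<^esub> (\<ominus>\<^bsub>M\<^esub> c) \<oplus>\<^bsub>M\<^esub> a \<odot>\<^bsub>M\<^esub> c = \<zero>\<^bsub>M\<^esub>"
    using assms smult_r_distr[of a "\<ominus>\<^bsub>M\<^esub> c" c] by (simp add: M.l_neg smult_r_zero)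
qed (use assms smult_closed in auto)

end

lemma regular_module_simps [simp]:
  "carrier (regular_module R) = carrier R" "add (regular_module R) = add R"
  "zero (regular_module R) = zero R" "smult (regular_module R) = mult R"
  by (simp_all add: regular_module_def)

lemma (in local_units_ring) regular_module_locally_unitary:
  "locally_unitary_module R (regular_module R)"
proof -
  have "abelian_group (regular_module R)"
  proof (rule abelian_groupI)
    show "\<exists>y\<in>carrier (regular_module R). y \<oplus>\<^bsub>regular_module R\<^esub> x = \<zero>\<^bsub>regular_module R\<^esub>"
      if "x \<in> carrier (regular_module R)" for x
      using that l_neg[of x] by auto
  qed (auto intro: a_assoc a_comm)
  then show ?thesis
    using mult_closed mult_assoc local_units distr mult_comm
    by (intro locally_unitary_module.intro locally_unitary_module_axioms.intro local_units_ring_axioms) auto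
qed

section \<open>The additive group of the tensor product\<close>

locale module_pair = C: locally_unitary_module R C + D: locally_unitary_module R D
  for R :: "('r, 's) ring_scheme" and C :: "('r, 'c, 'p) module_scheme"
    and D :: "('r, 'd, 'q) module_scheme"
begin

abbreviation "G \<equiv> free_Abelian_group (carrier C \<times> carrier D)"
abbreviation "N \<equiv> tensor_null R C D"
abbreviation "T \<equiv> tensor_product R C D"
abbreviation "cls \<equiv> tensor_class R C D"
abbreviation "pure \<equiv> pure_tensor R C D"

lemma keys_diff_subset:
  "Poly_Mapping.keys a \<subseteq> S \<Longrightarrow> Poly_Mapping.keys b \<subseteq> S \<Longrightarrow> Poly_Mapping.keys (a - b) \<subseteq> S"
  for a b :: "'x \<Rightarrow>\<^sub>0 int"
  using keys_diff[of a b] by blast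

lemma keys_add_subset:
  "Poly_Mapping.keys a \<subseteq> S \<Longrightarrow> Poly_Mapping.keys b \<subseteq> S \<Longrightarrow> Poly_Mapping.keys (a + b) \<subseteq> S"
  for a b :: "'x \<Rightarrow>\<^sub>0 int"
  using keys_add[of a b] by blast

text \<open>These closure rules replace the unfolding of the free group into conditions on keys,
  which is switched off below.\<close>

lemma free_closed [simp]:
  "0 \<in> carrier G"
  "z \<in> carrier G \<Longrightarrow> w \<in> carrier G \<Longrightarrow> z + w \<in> carrier G"
  "z \<in> carrier G \<Longrightarrow> w \<in> carrier G \<Longrightarrow> z - w \<in> carrier G"
  "z \<in> carrier G \<Longrightarrow> - z \<in> carrier G"
  by (simp_all add: keys_add_subset keys_diff_subset)

lemma free_inv [simp]: "z \<in> carrier G \<Longrightarrow> inv\<^bsub>G\<^esub> z = - z"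
  by simp

declare carrier_free_Abelian_group_iff [simp del]

lemma tensor_relatorsE:
  assumes "z \<in> tensor_relators R C D"
  obtains c c' d where "c \<in> carrier C" "c' \<in> carrier C" "d \<in> carrier D"
      "z = frag_of (c \<oplus>\<^bsub>C\<^esub> c', d) - frag_of (c, d) - frag_of (c', d)"
  | c d d' where "c \<in> carrier C" "d \<in> carrier D" "d' \<in> carrier D"
      "z = frag_of (c, d \<oplus>\<^bsub>D\<^esub> d') - frag_of (c, d) - frag_of (c, d')"
  | r c d where "r \<in> carrier R" "c \<in> carrier C" "d \<in> carrier D"
      "z = frag_of (r \<odot>\<^bsub>C\<^esub> c, d) - frag_of (c, r \<odot>\<^bsub>D\<^esub> d)"
  using assms unfolding tensor_relators_def
  by (elim UnE CollectE exE conjE) (rule that(1) that(2) that(3); assumption)+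

lemma tensor_relators_add_left:
  "c \<in> carrier C \<Longrightarrow> c' \<in> carrier C \<Longrightarrow> d \<in> carrier D \<Longrightarrow>
    frag_of (c \<oplus>\<^bsub>C\<^esub> c', d) - frag_of (c, d) - frag_of (c', d) \<in> tensor_relators R C D"
  unfolding tensor_relators_def by blast

lemma tensor_relators_add_right:
  "c \<in> carrier C \<Longrightarrow> d \<in> carrier D \<Longrightarrow> d' \<in> carrier D \<Longrightarrow>
    frag_of (c, d \<oplus>\<^bsub>D\<^esub> d') - frag_of (c, d) - frag_of (c, d') \<in> tensor_relators R C D"
  unfolding tensor_relators_def by blast

lemma tensor_relators_balanced:
  "r \<in> carrier R \<Longrightarrow> c \<in> carrier C \<Longrightarrow> d \<in> carrier D \<Longrightarrow>
    frag_of (r \<odot>\<^bsub>C\<^esub> c, d) - frag_of (c, r \<odot>\<^bsub>D\<^esub> d) \<in> tensor_relators R C D"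
  unfolding tensor_relators_def by blast

lemma tensor_relators_closed: "tensor_relators R C D \<subseteq> carrier G"
proof
  fix z assume "z \<in> tensor_relators R C D"
  then show "z \<in> carrier G"
    by (cases rule: tensor_relatorsE)
      (simp_all add: C.smult_closed D.smult_closed)
qed

lemma tensor_null_subgroup: "subgroup N G"
  unfolding tensor_null_def
  by (rule group.generate_is_subgroup[OF group_free_Abelian_group tensor_relators_closed])

lemma tensor_null_incl: "z \<in> tensor_relators R C D \<Longrightarrow> z \<in> N"
  unfolding tensor_null_def by (rule generate.incl)

text \<open>Bounds the subgroup of relations from above, once by its own preimage under scaling and
  once by the kernel of a lift; both make a map on representatives descend to classes.\<close>

lemma tensor_null_least:
  assumes "subgroup H G" "tensor_relators R C D \<subseteq> H"
  shows "N \<subseteq> H"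
  unfolding tensor_null_def
  by (rule group.generate_subgroup_incl[OF group_free_Abelian_group assms(2,1)])

lemma tensor_class_eq_iff:
  assumes "z \<in> carrier G" "w \<in> carrier G"
  shows "cls z = cls w \<longleftrightarrow> z - w \<in> N"
proof -
  interpret G: group G by simp
  interpret N: subgroup N G by (rule tensor_null_subgroup)
  have mem: "z \<in> cls w \<longleftrightarrow> z - w \<in> N"
    unfolding tensor_class_def r_coset_def by (auto simp: algebra_simps) (metis diff_add_cancel)
  show ?thesis
  proof
    assume "cls z = cls w"
    then show "z - w \<in> N"
      using G.rcos_self[OF assms(1) tensor_null_subgroup] mem unfolding tensor_class_def by simp
  next
    assume "z - w \<in> N"
    then have "z \<in> N #>\<^bsub>G\<^esub> w" using mem by (simp add: tensor_class_def)
    then show "cls z = cls w"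
      using G.repr_independence[OF _ assms(2) tensor_null_subgroup] by (simp add: tensor_class_def)
  qed
qed

text \<open>Discharges the choice operator in the scalar action and in \<open>tensor_lift\<close>:
  the chosen representative lies in the free group and defines the same class.\<close>

lemma tensor_class_some:
  assumes "z \<in> carrier G"
  shows "(SOME w. w \<in> cls z) \<in> carrier G" "cls (SOME w. w \<in> cls z) = cls z"
proof -
  interpret G: group G by simp
  have "z \<in> cls z"
    using G.rcos_self[OF assms tensor_null_subgroup] by (simp add: tensor_class_def)
  then have w: "(SOME w. w \<in> cls z) \<in> cls z" by (rule someI)
  then show c: "(SOME w. w \<in> cls z) \<in> carrier G"
    unfolding tensor_class_def
    using G.r_coset_subset_G[OF subgroup.subset[OF tensor_null_subgroup] assms] by blast
  show "cls (SOME w. w \<in> cls z) = cls z"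
    using w G.repr_independence[OF _ assms tensor_null_subgroup] by (simp add: tensor_class_def)
qed

lemma tensor_carrier: "carrier T = cls ` carrier G"
  by (auto simp: tensor_product_def Let_def RCOSETS_def tensor_class_def)

lemma tensor_zero: "\<zero>\<^bsub>T\<^esub> = cls 0"
proof -
  interpret G: group G by simp
  show ?thesis
    using G.coset_mult_one[OF subgroup.subset[OF tensor_null_subgroup]]
    by (simp add: tensor_product_def Let_def tensor_class_def)
qed

lemma tensor_add:
  assumes "z \<in> carrier G" "w \<in> carrier G"
  shows "cls z \<oplus>\<^bsub>T\<^esub> cls w = cls (z + w)"
proof -
  interpret G: comm_group G by (rule abelian_free_Abelian_group)
  have "normal N G"
    by (rule G.subgroup_imp_normal[OF tensor_null_subgroup])
  from normal.rcos_sum[OF this assms] show ?thesis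
    by (simp add: tensor_product_def Let_def tensor_class_def)
qed

lemma tensor_abelian_group: "abelian_group T"
proof (rule abelian_groupI)
  show "\<exists>y\<in>carrier T. y \<oplus>\<^bsub>T\<^esub> x = \<zero>\<^bsub>T\<^esub>" if "x \<in> carrier T" for x
  proof -
    from that obtain z where z: "z \<in> carrier G" "x = cls z" by (auto simp: tensor_carrier)
    then show ?thesis
      using tensor_add[of "- z" z]
      by (intro bexI[of _ "cls (- z)"]) (auto simp: tensor_carrier tensor_zero)
  qed
qed (auto simp: tensor_carrier tensor_zero tensor_add add_ac)

sublocale T: abelian_group T
  by (rule tensor_abelian_group)

lemma tensor_minus:
  assumes "z \<in> carrier G"
  shows "\<ominus>\<^bsub>T\<^esub> cls z = cls (- z)"
  using assms tensor_add[of "- z" z]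
  by (intro T.minus_equality) (auto simp: tensor_carrier tensor_zero)

lemma pure_closed: "c \<in> carrier C \<Longrightarrow> d \<in> carrier D \<Longrightarrow> pure c d \<in> carrier T"
  by (auto simp: pure_tensor_def tensor_carrier)

lemma cls_eqI:
  assumes "z \<in> carrier G" "w \<in> carrier G" "z - w \<in> tensor_relators R C D"
  shows "cls z = cls w"
  using tensor_class_eq_iff[OF assms(1,2)] tensor_null_incl[OF assms(3)] by simp

lemma pure_add_left:
  assumes "c \<in> carrier C" "c' \<in> carrier C" "d \<in> carrier D"
  shows "pure (c \<oplus>\<^bsub>C\<^esub> c') d = pure c d \<oplus>\<^bsub>T\<^esub> pure c' d"
proof -
  have "frag_of (c \<oplus>\<^bsub>C\<^esub> c', d) - (frag_of (c, d) + frag_of (c', d)) \<in> tensor_relators R C D"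
    using tensor_relators_add_left[OF assms] by (simp add: diff_diff_add)
  then have "cls (frag_of (c \<oplus>\<^bsub>C\<^esub> c', d)) = cls (frag_of (c, d) + frag_of (c', d))"
    by (rule cls_eqI[rotated 2]) (use assms in simp_all)
  then show ?thesis
    using assms by (simp add: pure_tensor_def tensor_add)
qed

lemma pure_add_right:
  assumes "c \<in> carrier C" "d \<in> carrier D" "d' \<in> carrier D"
  shows "pure c (d \<oplus>\<^bsub>D\<^esub> d') = pure c d \<oplus>\<^bsub>T\<^esub> pure c d'"
proof -
  have "frag_of (c, d \<oplus>\<^bsub>D\<^esub> d') - (frag_of (c, d) + frag_of (c, d')) \<in> tensor_relators R C D"
    using tensor_relators_add_right[OF assms] by (simp add: diff_diff_add)
  then have "cls (frag_of (c, d \<oplus>\<^bsub>D\<^esub> d')) = cls (frag_of (c, d) + frag_of (c, d'))"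
    by (rule cls_eqI[rotated 2]) (use assms in simp_all)
  then show ?thesis
    using assms by (simp add: pure_tensor_def tensor_add)
qed

lemma pure_balanced:
  assumes "r \<in> carrier R" "c \<in> carrier C" "d \<in> carrier D"
  shows "pure (r \<odot>\<^bsub>C\<^esub> c) d = pure c (r \<odot>\<^bsub>D\<^esub> d)"
  unfolding pure_tensor_def
  by (rule cls_eqI[OF _ _ tensor_relators_balanced[OF assms]])
    (use assms C.smult_closed D.smult_closed in simp_all)

lemma pure_zero_left:
  assumes "d \<in> carrier D"
  shows "pure \<zero>\<^bsub>C\<^esub> d = \<zero>\<^bsub>T\<^esub>"
  using pure_add_left[of "\<zero>\<^bsub>C\<^esub>" "\<zero>\<^bsub>C\<^esub>" d] pure_closed[of "\<zero>\<^bsub>C\<^esub>" d] assms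
  by (simp add: T.add.r_cancel_one')

lemma pure_minus_left:
  assumes "c \<in> carrier C" "d \<in> carrier D"
  shows "pure (\<ominus>\<^bsub>C\<^esub> c) d = \<ominus>\<^bsub>T\<^esub> pure c d"
proof (rule T.minus_equality[symmetric])
  show "pure (\<ominus>\<^bsub>C\<^esub> c) d \<oplus>\<^bsub>T\<^esub> pure c d = \<zero>\<^bsub>T\<^esub>"
    using assms pure_add_left[of "\<ominus>\<^bsub>C\<^esub> c" c d]
    by (simp add: C.M.l_neg pure_zero_left)
qed (use assms pure_closed in auto)

text \<open>No cases for 0 and for negatives occur, since both 0 and the negative of a pure tensor
  are pure: the sign can be moved into the left factor.\<close>

lemma tensor_induct [consumes 1, case_names pure add]:
  assumes t: "t \<in> carrier T"
    and pure: "\<And>c d. c \<in> carrier C \<Longrightarrow> d \<in> carrier D \<Longrightarrow> P (pure c d)"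
    and add: "\<And>t u. t \<in> carrier T \<Longrightarrow> u \<in> carrier T \<Longrightarrow> P t \<Longrightarrow> P u \<Longrightarrow> P (t \<oplus>\<^bsub>T\<^esub> u)"
  shows "P t"
proof -
  obtain z where z: "Poly_Mapping.keys z \<subseteq> carrier C \<times> carrier D" "t = cls z"
    using t by (auto simp: tensor_carrier carrier_free_Abelian_group_iff)
  \<comment> \<open>Induction in the free abelian group passes to differences a - b, so P is carried
    for -z along with z.\<close>
  have "P (cls z) \<and> P (cls (- z))"
  proof (rule free_Abelian_group_induct[OF z(1)])
    show "P (cls 0) \<and> P (cls (- 0))"
      using pure[of "\<zero>\<^bsub>C\<^esub>" "\<zero>\<^bsub>D\<^esub>"] by (simp add: pure_zero_left tensor_zero)
  next
    fix a b :: "'c \<times> 'd \<Rightarrow>\<^sub>0 int"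
    assume "Poly_Mapping.keys a \<subseteq> carrier C \<times> carrier D" "Poly_Mapping.keys b \<subseteq> carrier C \<times> carrier D"
    then have G: "a \<in> carrier G" "b \<in> carrier G" by (simp_all add: carrier_free_Abelian_group_iff)
    assume "P (cls a) \<and> P (cls (- a))" "P (cls b) \<and> P (cls (- b))"
    then show "P (cls (a - b)) \<and> P (cls (- (a - b)))"
      using G add[of "cls a" "cls (- b)"] add[of "cls b" "cls (- a)"]
      by (simp add: tensor_carrier tensor_add)
  next
    fix p assume "p \<in> carrier C \<times> carrier D"
    then obtain c d where p: "p = (c, d)" "c \<in> carrier C" "d \<in> carrier D" by auto
    have "cls (- frag_of p) = pure (\<ominus>\<^bsub>C\<^esub> c) d"
      using p pure_minus_left[of c d] by (simp add: pure_tensor_def tensor_minus)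
    then show "P (cls (frag_of p)) \<and> P (cls (- frag_of p))"
      using pure p by (simp add: pure_tensor_def)
  qed
  then show ?thesis using z by simp
qed

text \<open>Only the addition of E enters, so E may be a module over a ring other than R. In the
  sequel it is a stalk, or a tensor product of stalks over the germs.\<close>

lemma tensor_hom_eqI:
  assumes "f \<in> hom (add_monoid T) (add_monoid E)" "g \<in> hom (add_monoid T) (add_monoid E)"
    and "\<And>c d. c \<in> carrier C \<Longrightarrow> d \<in> carrier D \<Longrightarrow> f (pure c d) = g (pure c d)"
    and "t \<in> carrier T"
  shows "f t = g t"
  using assms(4)
proof (induction rule: tensor_induct)
  case (add t u)
  then show ?case using assms(1,2) by (simp add: hom_def)
qed (use assms in auto)

section \<open>The scalar action on the tensor product\<close>

definition scale :: "'r \<Rightarrow> ('c \<times> 'd \<Rightarrow>\<^sub>0 int) \<Rightarrow> ('c \<times> 'd \<Rightarrow>\<^sub>0 int)"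
  where "scale r = frag_extend (\<lambda>(c, d). frag_of (r \<odot>\<^bsub>C\<^esub> c, d))"

lemma scale_closed:
  assumes "r \<in> carrier R" "z \<in> carrier G"
  shows "scale r z \<in> carrier G"
proof -
  have "(\<Union>p\<in>Poly_Mapping.keys z. Poly_Mapping.keys (case p of (c, d) \<Rightarrow> frag_of (r \<odot>\<^bsub>C\<^esub> c, d)))
      \<subseteq> carrier C \<times> carrier D"
  proof (rule UN_least)
    fix p assume "p \<in> Poly_Mapping.keys z"
    then have "p \<in> carrier C \<times> carrier D"
      using assms(2) by (auto simp: carrier_free_Abelian_group_iff)
    then show "Poly_Mapping.keys (case p of (c, d) \<Rightarrow> frag_of (r \<odot>\<^bsub>C\<^esub> c, d)) \<subseteq> carrier C \<times> carrier D"
      using C.smult_closed[OF assms(1)] by (cases p) simp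
  qed
  then show ?thesis
    unfolding scale_def carrier_free_Abelian_group_iff by (rule order_trans[OF keys_frag_extend])
qed

text \<open>Makes the scalar action independent of the representative: scaling the left factor sends
  each kind of relator to a relator of the same kind.\<close>

lemma scale_tensor_null:
  assumes r: "r \<in> carrier R"
  shows "N \<subseteq> {z \<in> carrier G. scale r z \<in> N}"
proof (rule tensor_null_least)
  interpret G: group G by simp
  interpret N: subgroup N G by (rule tensor_null_subgroup)
  have N_minus: "- z \<in> N" if "z \<in> N" for z
    using N.m_inv_closed[OF that] N.subset that by auto
  show "subgroup {z \<in> carrier G. scale r z \<in> N} G"
    by (rule G.subgroupI)
      (use N.m_closed N.one_closed N_minus in
        \<open>auto simp: scale_def frag_extend_add frag_extend_minus intro!: exI[of _ 0]\<close>)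
  show "tensor_relators R C D \<subseteq> {z \<in> carrier G. scale r z \<in> N}"
  proof
    fix z assume z: "z \<in> tensor_relators R C D"
    from z have "scale r z \<in> tensor_relators R C D"
    proof (cases rule: tensor_relatorsE)
      case (1 c c' d)
      then show ?thesis
        using r tensor_relators_add_left[of "r \<odot>\<^bsub>C\<^esub> c" "r \<odot>\<^bsub>C\<^esub> c'" d]
        by (simp add: scale_def frag_extend_diff C.smult_closed C.smult_r_distr)
    next
      case (2 c d d')
      then show ?thesis
        using r tensor_relators_add_right[of "r \<odot>\<^bsub>C\<^esub> c" d d']
        by (simp add: scale_def frag_extend_diff C.smult_closed)
    next
      case (3 s c d)
      \<comment> \<open>Commutativity of R: the scaled balancing relator for s and c becomes the
        balancing relator for s and r c.\<close>
      have "r \<odot>\<^bsub>C\<^esub> (s \<odot>\<^bsub>C\<^esub> c) = s \<odot>\<^bsub>C\<^esub> (r \<odot>\<^bsub>C\<^esub> c)"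
        using r 3 C.smult_assoc[of r s c] C.smult_assoc[of s r c] C.mult_comm[of r s] by simp
      then show ?thesis
        using 3 r tensor_relators_balanced[of s "r \<odot>\<^bsub>C\<^esub> c" d]
        by (simp add: scale_def frag_extend_diff C.smult_closed)
    qed
    then show "z \<in> {z \<in> carrier G. scale r z \<in> N}"
      using tensor_null_incl z tensor_relators_closed by blast
  qed
qed

lemma tensor_smult:
  assumes r: "r \<in> carrier R" and z: "z \<in> carrier G"
  shows "r \<odot>\<^bsub>T\<^esub> cls z = cls (scale r z)"
proof -
  define w where "w = (SOME w. w \<in> cls z)"
  have w: "w \<in> carrier G" "cls w = cls z"
    using tensor_class_some[OF z] by (simp_all add: w_def)
  then have "w - z \<in> N" using tensor_class_eq_iff z by blast
  then have "scale r w - scale r z \<in> N"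
    using scale_tensor_null[OF r] by (auto simp: scale_def frag_extend_diff)
  then have "cls (scale r w) = cls (scale r z)"
    using tensor_class_eq_iff scale_closed r w z by blast
  then show ?thesis
    by (simp add: tensor_product_def Let_def w_def scale_def)
qed

lemma tensor_smult_pure:
  assumes "r \<in> carrier R" "c \<in> carrier C" "d \<in> carrier D"
  shows "r \<odot>\<^bsub>T\<^esub> pure c d = pure (r \<odot>\<^bsub>C\<^esub> c) d"
  unfolding pure_tensor_def using assms by (subst tensor_smult) (auto simp: scale_def)

lemma tensor_smult_closed: "r \<in> carrier R \<Longrightarrow> t \<in> carrier T \<Longrightarrow> r \<odot>\<^bsub>T\<^esub> t \<in> carrier T"
  unfolding tensor_carrier using tensor_smult scale_closed by fastforce

lemma tensor_smult_add:
  assumes "r \<in> carrier R" "t \<in> carrier T" "u \<in> carrier T"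
  shows "r \<odot>\<^bsub>T\<^esub> (t \<oplus>\<^bsub>T\<^esub> u) = r \<odot>\<^bsub>T\<^esub> t \<oplus>\<^bsub>T\<^esub> r \<odot>\<^bsub>T\<^esub> u"
proof -
  obtain z w where z: "z \<in> carrier G" "w \<in> carrier G" "t = cls z" "u = cls w"
    using assms by (auto simp only: tensor_carrier)
  have "scale r (z + w) = scale r z + scale r w"
    by (simp add: scale_def frag_extend_add)
  then show ?thesis
    using z assms(1) by (simp add: tensor_add tensor_smult scale_closed)
qed

text \<open>Local units come from those of C: a scalar that fixes the left factors of some
  expression of t as a sum of pure tensors also fixes t.\<close>

lemma tensor_locally_unitary: "locally_unitary_module R T"
proof -
  have fix1: "\<exists>F. finite F \<and> F \<subseteq> carrier C \<and>
      (\<forall>r\<in>carrier R. (\<forall>c\<in>F. r \<odot>\<^bsub>C\<^esub> c = c) \<longrightarrow> r \<odot>\<^bsub>T\<^esub> t = t)" if "t \<in> carrier T" for t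
    using that
  proof (induction rule: tensor_induct)
    case (pure c d)
    then show ?case by (intro exI[of _ "{c}"]) (auto simp: tensor_smult_pure)
  next
    case (add t u)
    then obtain F F' where
      "finite F" "F \<subseteq> carrier C" "\<forall>r\<in>carrier R. (\<forall>c\<in>F. r \<odot>\<^bsub>C\<^esub> c = c) \<longrightarrow> r \<odot>\<^bsub>T\<^esub> t = t"
      "finite F'" "F' \<subseteq> carrier C" "\<forall>r\<in>carrier R. (\<forall>c\<in>F'. r \<odot>\<^bsub>C\<^esub> c = c) \<longrightarrow> r \<odot>\<^bsub>T\<^esub> u = u"
      by auto
    then show ?case
      using add(1,2) by (intro exI[of _ "F \<union> F'"]) (auto simp: tensor_smult_add)
  qed
  show ?thesis
  proof (intro locally_unitary_module.intro locally_unitary_module_axioms.intro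
      C.local_units_ring_axioms tensor_abelian_group)
    fix a b t assume a: "a \<in> carrier R" and b: "b \<in> carrier R" and t: "t \<in> carrier T"
    show "a \<odot>\<^bsub>T\<^esub> t \<in> carrier T" using a t by (rule tensor_smult_closed)
    show "(a \<oplus>\<^bsub>R\<^esub> b) \<odot>\<^bsub>T\<^esub> t = a \<odot>\<^bsub>T\<^esub> t \<oplus>\<^bsub>T\<^esub> b \<odot>\<^bsub>T\<^esub> t"
      using t
    proof (induction rule: tensor_induct)
      case (pure c d)
      then show ?case using a b
        by (simp add: tensor_smult_pure C.smult_l_distr pure_add_left C.smult_closed)
    next
      case (add t u)
      then show ?case using a b
        by (simp add: tensor_smult_add tensor_smult_closed T.a_ac)
    qed
    show "(a \<otimes>\<^bsub>R\<^esub> b) \<odot>\<^bsub>T\<^esub> t = a \<odot>\<^bsub>T\<^esub> (b \<odot>\<^bsub>T\<^esub> t)"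
      using t
    proof (induction rule: tensor_induct)
      case (pure c d)
      then show ?case using a b
        by (simp add: tensor_smult_pure C.smult_assoc C.mult_closed C.smult_closed)
    next
      case (add t u)
      then show ?case using a b
        by (simp add: tensor_smult_add tensor_smult_closed C.mult_closed)
    qed
  next
    fix F assume F: "finite F" "F \<subseteq> carrier T"
    then have "\<exists>f. \<forall>t\<in>F. finite (f t) \<and> f t \<subseteq> carrier C \<and>
      (\<forall>r\<in>carrier R. (\<forall>c\<in>f t. r \<odot>\<^bsub>C\<^esub> c = c) \<longrightarrow> r \<odot>\<^bsub>T\<^esub> t = t)"
      using fix1 by (intro bchoice) blast
    then obtain f where f: "\<forall>t\<in>F. finite (f t) \<and> f t \<subseteq> carrier C \<and>
      (\<forall>r\<in>carrier R. (\<forall>c\<in>f t. r \<odot>\<^bsub>C\<^esub> c = c) \<longrightarrow> r \<odot>\<^bsub>T\<^esub> t = t)"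
      by (rule exE)
    have "finite (\<Union> (f ` F))" "\<Union> (f ` F) \<subseteq> carrier C"
      using f F by auto
    then obtain r where "r \<in> carrier R" "\<forall>c\<in>\<Union> (f ` F). r \<odot>\<^bsub>C\<^esub> c = c"
      using C.locally_unitary by blast
    then show "\<exists>r\<in>carrier R. \<forall>c\<in>F. r \<odot>\<^bsub>T\<^esub> c = c"
      using f by (intro bexI[of _ r]) auto
  qed (rule tensor_smult_add)
qed

end

section \<open>The universal property of the tensor product\<close>

locale balanced_map = module_pair R C D + E: abelian_group E
  for R :: "('r, 's) ring_scheme" and C :: "('r, 'c, 'p) module_scheme"
    and D :: "('r, 'd, 'q) module_scheme" and E :: "('e, 't) ring_scheme" +
  fixes \<phi> :: "'c \<Rightarrow> 'd \<Rightarrow> 'e"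
  assumes map_closed: "c \<in> carrier C \<Longrightarrow> d \<in> carrier D \<Longrightarrow> \<phi> c d \<in> carrier E"
    and add_left: "c \<in> carrier C \<Longrightarrow> c' \<in> carrier C \<Longrightarrow> d \<in> carrier D \<Longrightarrow>
      \<phi> (c \<oplus>\<^bsub>C\<^esub> c') d = \<phi> c d \<oplus>\<^bsub>E\<^esub> \<phi> c' d"
    and add_right: "c \<in> carrier C \<Longrightarrow> d \<in> carrier D \<Longrightarrow> d' \<in> carrier D \<Longrightarrow>
      \<phi> c (d \<oplus>\<^bsub>D\<^esub> d') = \<phi> c d \<oplus>\<^bsub>E\<^esub> \<phi> c d'"
    and balanced: "r \<in> carrier R \<Longrightarrow> c \<in> carrier C \<Longrightarrow> d \<in> carrier D \<Longrightarrow>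
      \<phi> (r \<odot>\<^bsub>C\<^esub> c) d = \<phi> c (r \<odot>\<^bsub>D\<^esub> d)"
begin

text \<open>\<open>tensor_lift\<close> is an explicit sum over one chosen representative. The
  homomorphism h from the universal property of the free abelian group equals that sum on every
  representative, and biadditivity and balance say that h kills the relators, so the choice is
  immaterial.\<close>

lemma tensor_lift_ex:
  obtains h where "h \<in> hom G (add_monoid E)" "\<And>z. z \<in> carrier G \<Longrightarrow> tensor_lift E \<phi> (cls z) = h z"
    "\<And>c d. c \<in> carrier C \<Longrightarrow> d \<in> carrier D \<Longrightarrow> h (frag_of (c, d)) = \<phi> c d"
proof -
  interpret G: group G by simp
  obtain h where h: "h \<in> hom G (add_monoid E)"
    and h_of: "\<And>p. p \<in> carrier C \<times> carrier D \<Longrightarrow> h (frag_of p) = (case p of (c, d) \<Rightarrow> \<phi> c d)"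
  proof (rule comm_group.free_Abelian_group_universal[OF E.a_comm_group,
        of "\<lambda>(c, d). \<phi> c d" "carrier C \<times> carrier D"])
    show "(\<lambda>(c, d). \<phi> c d) ` (carrier C \<times> carrier D) \<subseteq> carrier (add_monoid E)"
      using map_closed by auto
  qed blast
  interpret h: group_hom G "add_monoid E" h
    by (intro group_hom.intro group_hom_axioms.intro h G.group_axioms E.a_group)
  have h_closed: "h z \<in> carrier E" if "z \<in> carrier G" for z
    using h.hom_closed[OF that] by simp
  have h_diff: "h (a - b) = h a \<ominus>\<^bsub>E\<^esub> h b" if "a \<in> carrier G" "b \<in> carrier G" for a b
    using h.hom_mult[of a "- b"] h.hom_inv[of b] that
    by (simp add: a_minus_def a_inv_def)
  \<comment> \<open>I and the coefficients are arbitrary to allow induction on I; the case of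
    interest is the support of z with the coefficients of z.\<close>
  have sum: "(\<Oplus>\<^bsub>E\<^esub>p\<in>I. [a p] \<cdot>\<^bsub>E\<^esub> \<phi> (fst p) (snd p)) = h (\<Sum>p\<in>I. frag_cmul (a p) (frag_of p))"
    if "finite I" "I \<subseteq> carrier C \<times> carrier D" for I a
    using that
  proof (induction I)
    case empty
    then show ?case using h.hom_one by simp
  next
    case (insert p I)
    have p: "p \<in> carrier C \<times> carrier D" using insert by auto
    have hp: "h (frag_cmul (a p) (frag_of p)) = [a p] \<cdot>\<^bsub>E\<^esub> \<phi> (fst p) (snd p)"
      using h.hom_int_pow[of "frag_of p" "a p"] p h_of[OF p]
      by (auto simp: int_pow_free_Abelian_group add_pow_def)
    have keys: "frag_cmul (a p) (frag_of p) \<in> carrier G"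
      "(\<Sum>p\<in>I. frag_cmul (a p) (frag_of p)) \<in> carrier G"
      using p insert.prems keys_cmul[of _ "frag_of _"] unfolding carrier_free_Abelian_group_iff
      by (fastforce, intro sum_closed_free_Abelian_group[unfolded carrier_free_Abelian_group_iff]) fastforce
    show ?case
      using insert h.hom_mult[OF keys] map_closed hp p
      by (subst E.finsum_insert) auto
  qed
  have lift: "(\<Oplus>\<^bsub>E\<^esub>p\<in>Poly_Mapping.keys z. [Poly_Mapping.lookup z p] \<cdot>\<^bsub>E\<^esub> \<phi> (fst p) (snd p)) = h z"
    if "z \<in> carrier G" for z
    using sum[of "Poly_Mapping.keys z" "Poly_Mapping.lookup z"] that
      frag_expansion[of z, unfolded frag_extend_def, symmetric]
    by (simp add: carrier_free_Abelian_group_iff)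
  have "N \<subseteq> kernel G (add_monoid E) h"
  proof (rule tensor_null_least[OF h.subgroup_kernel], rule subsetI)
    fix z assume z: "z \<in> tensor_relators R C D"
    then have zG: "z \<in> carrier G" using tensor_relators_closed by blast
    from z have "h z = \<zero>\<^bsub>E\<^esub>"
    proof (cases rule: tensor_relatorsE)
      case (1 c c' d)
      have "h z = h (frag_of (c \<oplus>\<^bsub>C\<^esub> c', d)) \<ominus>\<^bsub>E\<^esub> h (frag_of (c, d)) \<ominus>\<^bsub>E\<^esub> h (frag_of (c', d))"
        using 1 by (simp add: h_diff)
      also have "\<dots> = \<zero>\<^bsub>E\<^esub>"
        using 1 map_closed[of c d] map_closed[of c' d]
        by (simp add: h_of add_left a_minus_def E.minus_add E.r_neg E.r_neg1 E.r_neg2 E.a_ac)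
      finally show ?thesis .
    next
      case (2 c d d')
      have "h z = h (frag_of (c, d \<oplus>\<^bsub>D\<^esub> d')) \<ominus>\<^bsub>E\<^esub> h (frag_of (c, d)) \<ominus>\<^bsub>E\<^esub> h (frag_of (c, d'))"
        using 2 by (simp add: h_diff)
      also have "\<dots> = \<zero>\<^bsub>E\<^esub>"
        using 2 map_closed[of c d] map_closed[of c d']
        by (simp add: h_of add_right a_minus_def E.minus_add E.r_neg E.r_neg1 E.r_neg2 E.a_ac)
      finally show ?thesis .
    next
      case (3 r c d)
      have "h z = h (frag_of (r \<odot>\<^bsub>C\<^esub> c, d)) \<ominus>\<^bsub>E\<^esub> h (frag_of (c, r \<odot>\<^bsub>D\<^esub> d))"
        using 3 C.smult_closed D.smult_closed by (simp add: h_diff)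
      also have "\<dots> = \<zero>\<^bsub>E\<^esub>"
        using 3 C.smult_closed D.smult_closed map_closed[of c "r \<odot>\<^bsub>D\<^esub> d"]
        by (simp add: h_of balanced a_minus_def E.r_neg)
      finally show ?thesis .
    qed
    with zG show "z \<in> kernel G (add_monoid E) h" by (simp add: kernel_def)
  qed
  have "tensor_lift E \<phi> (cls z) = h z" if z: "z \<in> carrier G" for z
  proof -
    define w where "w = (SOME w. w \<in> cls z)"
    have w: "w \<in> carrier G" "cls w = cls z"
      using tensor_class_some[OF z] by (simp_all add: w_def)
    then have "w - z \<in> N" using tensor_class_eq_iff z by blast
    then have "h (w - z) = \<zero>\<^bsub>E\<^esub>"
      using \<open>N \<subseteq> kernel G (add_monoid E) h\<close> by (auto simp: kernel_def)
    then have "h w = h z"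
      using h.hom_mult[of "w - z" z] h_closed w z by simp
    then show ?thesis
      using lift[OF w(1)] by (simp add: tensor_lift_def Let_def w_def)
  qed
  then show thesis using that[OF h] h_of by auto
qed

lemma tensor_lift_pure:
  assumes "c \<in> carrier C" "d \<in> carrier D"
  shows "tensor_lift E \<phi> (pure c d) = \<phi> c d"
proof -
  obtain h where h: "h \<in> hom G (add_monoid E)" "\<And>z. z \<in> carrier G \<Longrightarrow> tensor_lift E \<phi> (cls z) = h z"
    "\<And>c d. c \<in> carrier C \<Longrightarrow> d \<in> carrier D \<Longrightarrow> h (frag_of (c, d)) = \<phi> c d"
    by (rule tensor_lift_ex) (rule that)
  then show ?thesis using assms by (simp add: pure_tensor_def)
qed

lemma tensor_lift_hom: "tensor_lift E \<phi> \<in> hom (add_monoid T) (add_monoid E)"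
proof -
  obtain h where h: "h \<in> hom G (add_monoid E)" "\<And>z. z \<in> carrier G \<Longrightarrow> tensor_lift E \<phi> (cls z) = h z"
    "\<And>c d. c \<in> carrier C \<Longrightarrow> d \<in> carrier D \<Longrightarrow> h (frag_of (c, d)) = \<phi> c d"
    by (rule tensor_lift_ex) (rule that)
  show ?thesis
  proof (rule homI)
    show "tensor_lift E \<phi> t \<in> carrier (add_monoid E)" if t: "t \<in> carrier (add_monoid T)" for t
    proof -
      from t obtain z where z: "z \<in> carrier G" "t = cls z" by (auto simp: tensor_carrier)
      then show ?thesis using hom_in_carrier[OF h(1) z(1)] h(2) by simp
    qed
    show "tensor_lift E \<phi> (t \<otimes>\<^bsub>add_monoid T\<^esub> u) = tensor_lift E \<phi> t \<otimes>\<^bsub>add_monoid E\<^esub> tensor_lift E \<phi> u"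
      if t: "t \<in> carrier (add_monoid T)" "u \<in> carrier (add_monoid T)" for t u
    proof -
      from t obtain z w where z: "z \<in> carrier G" "t = cls z" "w \<in> carrier G" "u = cls w"
        by (auto simp: tensor_carrier)
      then show ?thesis
        using hom_mult[OF h(1) z(1,3)] h(2) by (simp add: tensor_add)
    qed
  qed
qed

end

section \<open>Linear maps and functoriality of the tensor product\<close>

lemma linear_mapsI:
  assumes "\<And>c. c \<in> carrier C \<Longrightarrow> \<alpha> c \<in> carrier D"
    and "\<And>c c'. c \<in> carrier C \<Longrightarrow> c' \<in> carrier C \<Longrightarrow> \<alpha> (c \<oplus>\<^bsub>C\<^esub> c') = \<alpha> c \<oplus>\<^bsub>D\<^esub> \<alpha> c'"
    and "\<And>r c. r \<in> carrier R \<Longrightarrow> c \<in> carrier C \<Longrightarrow> \<alpha> (r \<odot>\<^bsub>C\<^esub> c) = r \<odot>\<^bsub>D\<^esub> \<alpha> c"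
  shows "\<alpha> \<in> linear_maps R C D"
  using assms by (simp add: linear_maps_def)

lemma linear_mapsD:
  assumes "\<alpha> \<in> linear_maps R C D"
  shows "c \<in> carrier C \<Longrightarrow> \<alpha> c \<in> carrier D"
    and "c \<in> carrier C \<Longrightarrow> c' \<in> carrier C \<Longrightarrow> \<alpha> (c \<oplus>\<^bsub>C\<^esub> c') = \<alpha> c \<oplus>\<^bsub>D\<^esub> \<alpha> c'"
    and "r \<in> carrier R \<Longrightarrow> c \<in> carrier C \<Longrightarrow> \<alpha> (r \<odot>\<^bsub>C\<^esub> c) = r \<odot>\<^bsub>D\<^esub> \<alpha> c"
  using assms by (auto simp: linear_maps_def)

lemma id_linear: "id \<in> linear_maps R C C"
  by (rule linear_mapsI) simp_all

lemma hom_addD: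
  assumes "h \<in> hom (add_monoid C) (add_monoid D)"
  shows "c \<in> carrier C \<Longrightarrow> h c \<in> carrier D"
    and "c \<in> carrier C \<Longrightarrow> c' \<in> carrier C \<Longrightarrow> h (c \<oplus>\<^bsub>C\<^esub> c') = h c \<oplus>\<^bsub>D\<^esub> h c'"
  using assms by (auto simp: hom_def)

lemma hom_addI:
  assumes "\<And>c. c \<in> carrier C \<Longrightarrow> h c \<in> carrier D"
    and "\<And>c c'. c \<in> carrier C \<Longrightarrow> c' \<in> carrier C \<Longrightarrow> h (c \<oplus>\<^bsub>C\<^esub> c') = h c \<oplus>\<^bsub>D\<^esub> h c'"
  shows "h \<in> hom (add_monoid C) (add_monoid D)"
  using assms by (simp add: hom_def)

lemma hom_add_comp:
  assumes "g \<in> hom (add_monoid C) (add_monoid D)" "h \<in> hom (add_monoid D) (add_monoid E)"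
  shows "(\<lambda>c. h (g c)) \<in> hom (add_monoid C) (add_monoid E)"
  by (rule hom_addI) (simp_all add: hom_addD[OF assms(1)] hom_addD[OF assms(2)])

text \<open>Well-definedness of \<alpha> \<otimes> \<beta>: linearity pulls the relations between
  pure tensors of C' and D' back to C and D.\<close>

lemma tensor_map_balanced:
  assumes C: "locally_unitary_module R C" and D: "locally_unitary_module R D"
    and C': "locally_unitary_module R C'" and D': "locally_unitary_module R D'"
    and \<alpha>: "\<alpha> \<in> linear_maps R C C'" and \<beta>: "\<beta> \<in> linear_maps R D D'"
  shows "balanced_map R C D (tensor_product R C' D') (\<lambda>c d. pure_tensor R C' D' (\<alpha> c) (\<beta> d))"
proof -
  note mp = module_pair.intro[OF C' D']
  note \<alpha> = linear_mapsD[OF \<alpha>] and \<beta> = linear_mapsD[OF \<beta>]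
  show ?thesis
    by (intro balanced_map.intro balanced_map_axioms.intro module_pair.intro C D
        module_pair.tensor_abelian_group[OF mp])
      (simp_all add: \<alpha> \<beta> module_pair.pure_closed[OF mp] module_pair.pure_add_left[OF mp]
        module_pair.pure_add_right[OF mp] module_pair.pure_balanced[OF mp])
qed

lemma tensor_map_hom:
  assumes "locally_unitary_module R C" "locally_unitary_module R D"
    "locally_unitary_module R C'" "locally_unitary_module R D'"
    "\<alpha> \<in> linear_maps R C C'" "\<beta> \<in> linear_maps R D D'"
  shows "tensor_map R C' D' \<alpha> \<beta> \<in>
    hom (add_monoid (tensor_product R C D)) (add_monoid (tensor_product R C' D'))"
  unfolding tensor_map_def by (rule balanced_map.tensor_lift_hom[OF tensor_map_balanced[OF assms]])

lemma tensor_map_pure: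
  assumes "locally_unitary_module R C" "locally_unitary_module R D"
    "locally_unitary_module R C'" "locally_unitary_module R D'"
    "\<alpha> \<in> linear_maps R C C'" "\<beta> \<in> linear_maps R D D'" "c \<in> carrier C" "d \<in> carrier D"
  shows "tensor_map R C' D' \<alpha> \<beta> (pure_tensor R C D c d) = pure_tensor R C' D' (\<alpha> c) (\<beta> d)"
  unfolding tensor_map_def by (rule balanced_map.tensor_lift_pure[OF tensor_map_balanced[OF assms(1-6)] assms(7,8)])

section \<open>Contraction of a tensor product with the ring\<close>

context locally_unitary_module
begin

text \<open>Balance amounts to d (r c) = (r d) c and so rests on the commutativity of R.\<close>

lemma right_action_balanced:
  "balanced_map R M (regular_module R) M (\<lambda>c r. r \<odot>\<^bsub>M\<^esub> c)"
proof (intro balanced_map.intro balanced_map_axioms.intro module_pair.intro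
    locally_unitary_module_axioms regular_module_locally_unitary M.abelian_group_axioms)
  show "d \<odot>\<^bsub>M\<^esub> (r \<odot>\<^bsub>M\<^esub> c) = (r \<odot>\<^bsub>regular_module R\<^esub> d) \<odot>\<^bsub>M\<^esub> c"
    if "r \<in> carrier R" "c \<in> carrier M" "d \<in> carrier (regular_module R)" for r c d
    using that smult_assoc[of d r c] mult_comm[of r d] by simp
qed (simp_all add: smult_closed smult_l_distr smult_r_distr)

lemma left_action_balanced:
  "balanced_map R (regular_module R) M M (\<lambda>r c. r \<odot>\<^bsub>M\<^esub> c)"
proof (intro balanced_map.intro balanced_map_axioms.intro module_pair.intro
    locally_unitary_module_axioms regular_module_locally_unitary M.abelian_group_axioms)
  show "(r \<odot>\<^bsub>regular_module R\<^esub> c) \<odot>\<^bsub>M\<^esub> d = c \<odot>\<^bsub>M\<^esub> (r \<odot>\<^bsub>M\<^esub> d)"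
    if "r \<in> carrier R" "c \<in> carrier (regular_module R)" "d \<in> carrier M" for r c d
    using that smult_assoc[of c r d] mult_comm[of r c] by simp
qed (simp_all add: smult_closed smult_l_distr smult_r_distr)

text \<open>Write c = r c with a local unit r; then u c = (u r) c = r c = c. Applied to the germ of
  1 acting on tensors of stalks.\<close>

lemma one_smult:
  assumes "u \<in> carrier R" "\<And>r. r \<in> carrier R \<Longrightarrow> u \<otimes>\<^bsub>R\<^esub> r = r" "c \<in> carrier M"
  shows "u \<odot>\<^bsub>M\<^esub> c = c"
proof -
  obtain r where "r \<in> carrier R" "r \<odot>\<^bsub>M\<^esub> c = c"
    using locally_unitary[of "{c}"] assms(3) by auto
  then show ?thesis
    using assms smult_assoc[of u r c] by simp
qed

end

section \<open>Germs and stalks\<close>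

text \<open>The operations on germs and the action on stalks are unions over all representatives of
  sets that coincide; this collapses such a union.\<close>

lemma UN_UN_const:
  assumes "a \<in> X" "b \<in> Y" "\<And>a b. a \<in> X \<Longrightarrow> b \<in> Y \<Longrightarrow> F a b = K"
  shows "(\<Union>a\<in>X. \<Union>b\<in>Y. F a b) = K"
  using assms by auto

text \<open>R and S are parameters tied to the concrete rings by equations, so that the records stay
  folded until \<open>R_eq\<close> or \<open>S_eq\<close> is invoked. That R has local units is an
  assumption here; in the theorem it is supplied by the coalgebra, whose definition includes a base
  ring with local units.\<close>

locale manifold_point =
  fixes n :: nat and A :: "'m::t2_space chart set" and x :: 'm
    and R :: "('m \<Rightarrow> 'f::real_normed_field) ring" and S :: "('m \<Rightarrow> 'f) set ring"
  assumes atlas: "smooth_atlas n A"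
    and R_eq: "R = Cc_ring n A" and S_eq: "S = germ_ring n A x"
    and R_local_units: "local_units_ring R"
begin

sublocale R: local_units_ring R
  by (rule R_local_units)

abbreviation \<gamma> :: "('m \<Rightarrow> 'f) \<Rightarrow> ('m \<Rightarrow> 'f) set"
  where "\<gamma> \<equiv> germ n A x"

lemma R_simps: "f \<otimes>\<^bsub>R\<^esub> g = (\<lambda>y. f y * g y)" "f \<oplus>\<^bsub>R\<^esub> g = (\<lambda>y. f y + g y)" "\<zero>\<^bsub>R\<^esub> = (\<lambda>y. 0)"
  by (simp_all add: R_eq Cc_ring_def)

lemma S_one: "\<one>\<^bsub>S\<^esub> = \<gamma> (\<lambda>y. 1)"
  by (simp add: S_eq germ_ring_def)

lemma R_smooth: "f \<in> carrier R \<Longrightarrow> smooth_fun n A UNIV f"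
  by (simp add: R_eq Cc_ring_def)

lemma germ_self: "open W \<Longrightarrow> x \<in> W \<Longrightarrow> smooth_fun n A W f \<Longrightarrow> f \<in> \<gamma> f"
  by (auto simp: germ_def)

lemma R_germ_self: "f \<in> carrier R \<Longrightarrow> f \<in> \<gamma> f"
  using germ_self[OF open_UNIV UNIV_I R_smooth] .

lemma germ_subset:
  assumes "open W" "x \<in> W" "\<And>y. y \<in> W \<Longrightarrow> f y = g y"
  shows "\<gamma> f \<subseteq> \<gamma> g"
proof
  fix h assume "h \<in> \<gamma> f"
  then obtain V where V: "open V" "x \<in> V" "smooth_fun n A V h" "\<forall>y\<in>V. h y = f y"
    by (auto simp: germ_def)
  have "smooth_fun n A (V \<inter> W) h"
    by (rule smooth_fun_subset[OF atlas V(3)]) simp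
  with V assms show "h \<in> \<gamma> g"
    unfolding germ_def by (intro CollectI exI[of _ "V \<inter> W"]) auto
qed

lemma germ_cong:
  assumes "open W" "x \<in> W" "\<And>y. y \<in> W \<Longrightarrow> f y = g y"
  shows "\<gamma> f = \<gamma> g"
  using germ_subset[of W f g] germ_subset[of W g f] assms by auto

lemma germ_memE:
  assumes "g \<in> \<gamma> f"
  obtains W where "open W" "x \<in> W" "\<And>y. y \<in> W \<Longrightarrow> g y = f y"
  using assms by (auto simp: germ_def)

lemma germ_mem_eq: "g \<in> \<gamma> f \<Longrightarrow> \<gamma> g = \<gamma> f"
  by (erule germ_memE) (rule germ_cong)

lemma germ_represented:
  assumes "open W" "x \<in> W" "smooth_fun n A W f"
  obtains g where "g \<in> carrier R" "\<gamma> g = \<gamma> f" "\<And>y. y \<notin> W \<Longrightarrow> g y = 0"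
proof -
  obtain g W' where "g \<in> carrier (Cc_ring n A)" "open W'" "x \<in> W'" "W' \<subseteq> W"
    "\<And>y. y \<in> W' \<Longrightarrow> g y = f y" "\<And>y. y \<notin> W \<Longrightarrow> g y = 0"
    by (rule Cc_ring_extension[OF atlas assms]) (rule that)
  then show thesis using germ_cong[of W' g f] by (intro that[of g]) (auto simp: R_eq)
qed

text \<open>The substitutes for an identity of R. Vanishing off W lets e discard whatever happens
  away from x.\<close>

lemma unit_germ_ex:
  assumes "open W" "x \<in> W"
  obtains e where "e \<in> carrier R" "\<gamma> e = \<one>\<^bsub>S\<^esub>" "\<And>y. y \<notin> W \<Longrightarrow> e y = 0"
proof -
  obtain e where "e \<in> carrier R" "\<gamma> e = \<gamma> (\<lambda>y. 1)" "\<And>y. y \<notin> W \<Longrightarrow> e y = 0"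
    by (rule germ_represented[OF assms smooth_fun_const[OF atlas, of W 1]]) (rule that)
  then show thesis by (intro that[of e]) (simp_all add: S_one)
qed

text \<open>Lets every germ be written as \<gamma> f with f in R, so that the operations of S can be
  computed in R.\<close>

lemma germ_carrier: "carrier S = \<gamma> ` carrier R"
proof
  show "carrier S \<subseteq> \<gamma> ` carrier R"
  proof
    fix s assume "s \<in> carrier S"
    then obtain f W where f: "s = \<gamma> f" "open W" "x \<in> W" "smooth_fun n A W f"
      by (auto simp: S_eq germ_ring_def)
    obtain g where "g \<in> carrier R" "\<gamma> g = \<gamma> f"
      by (rule germ_represented[OF f(2-4)]) (rule that)
    then show "s \<in> \<gamma> ` carrier R"
      unfolding f(1) by (metis imageI)
  qed
  show "\<gamma> ` carrier R \<subseteq> carrier S"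
    using R_smooth by (auto simp: S_eq germ_ring_def)
qed

lemma germ_unit_near:
  assumes "e \<in> carrier R" "\<gamma> e = \<one>\<^bsub>S\<^esub>"
  obtains W where "open W" "x \<in> W" "\<And>y. y \<in> W \<Longrightarrow> e y = 1"
proof -
  have "e \<in> \<gamma> (\<lambda>y. 1)" using assms R_germ_self[of e] S_one by simp
  then show thesis using that by (rule germ_memE)
qed

lemma germ_mult: 
  assumes "f \<in> carrier R" "g \<in> carrier R"
  shows "\<gamma> f \<otimes>\<^bsub>S\<^esub> \<gamma> g = \<gamma> (f \<otimes>\<^bsub>R\<^esub> g)"
proof -
  have "\<gamma> (\<lambda>y. f' y * g' y) = \<gamma> (\<lambda>y. f y * g y)" if f': "f' \<in> \<gamma> f" and g': "g' \<in> \<gamma> g" for f' g'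
  proof -
    obtain V where V: "open V" "x \<in> V" "\<And>y. y \<in> V \<Longrightarrow> f' y = f y"
      by (rule germ_memE[OF f']) (rule that)
    obtain W where W: "open W" "x \<in> W" "\<And>y. y \<in> W \<Longrightarrow> g' y = g y"
      by (rule germ_memE[OF g']) (rule that)
    show ?thesis by (rule germ_cong[of "V \<inter> W"]) (use V W in auto)
  qed
  then have "(\<Union>f'\<in>\<gamma> f. \<Union>g'\<in>\<gamma> g. \<gamma> (\<lambda>y. f' y * g' y)) = \<gamma> (\<lambda>y. f y * g y)"
    by (rule UN_UN_const[OF R_germ_self[OF assms(1)] R_germ_self[OF assms(2)]])
  then show ?thesis by (simp add: S_eq germ_ring_def R_simps)
qed

lemma germ_add:
  assumes "f \<in> carrier R" "g \<in> carrier R"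
  shows "\<gamma> f \<oplus>\<^bsub>S\<^esub> \<gamma> g = \<gamma> (f \<oplus>\<^bsub>R\<^esub> g)"
proof -
  have "\<gamma> (\<lambda>y. f' y + g' y) = \<gamma> (\<lambda>y. f y + g y)" if f': "f' \<in> \<gamma> f" and g': "g' \<in> \<gamma> g" for f' g'
  proof -
    obtain V where V: "open V" "x \<in> V" "\<And>y. y \<in> V \<Longrightarrow> f' y = f y"
      by (rule germ_memE[OF f']) (rule that)
    obtain W where W: "open W" "x \<in> W" "\<And>y. y \<in> W \<Longrightarrow> g' y = g y"
      by (rule germ_memE[OF g']) (rule that)
    show ?thesis by (rule germ_cong[of "V \<inter> W"]) (use V W in auto)
  qed
  then have "(\<Union>f'\<in>\<gamma> f. \<Union>g'\<in>\<gamma> g. \<gamma> (\<lambda>y. f' y + g' y)) = \<gamma> (\<lambda>y. f y + g y)"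
    by (rule UN_UN_const[OF R_germ_self[OF assms(1)] R_germ_self[OF assms(2)]])
  then show ?thesis by (simp add: S_eq germ_ring_def R_simps)
qed

lemma germ_zero: "\<zero>\<^bsub>S\<^esub> = \<gamma> \<zero>\<^bsub>R\<^esub>"
  by (simp add: S_eq germ_ring_def R_simps)

text \<open>Turns equality of germs into algebra in R. For functions that agree on a neighbourhood W
  of x, take e with germ 1 vanishing off W; conversely, e is 1 near x and drops out of the equation
  there.\<close>

lemma germ_eq_iff:
  assumes "f \<in> carrier R" "g \<in> carrier R"
  shows "\<gamma> f = \<gamma> g \<longleftrightarrow> (\<exists>e\<in>carrier R. \<gamma> e = \<one>\<^bsub>S\<^esub> \<and> e \<otimes>\<^bsub>R\<^esub> f = e \<otimes>\<^bsub>R\<^esub> g)"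
proof
  assume "\<gamma> f = \<gamma> g"
  then have "f \<in> \<gamma> g" using R_germ_self[OF assms(1)] by simp
  then obtain W where W: "open W" "x \<in> W" "\<And>y. y \<in> W \<Longrightarrow> f y = g y"
    by (rule germ_memE) (rule that)
  obtain e where e: "e \<in> carrier R" "\<gamma> e = \<one>\<^bsub>S\<^esub>" "\<And>y. y \<notin> W \<Longrightarrow> e y = 0"
    by (rule unit_germ_ex[OF W(1,2)]) (rule that)
  have "e \<otimes>\<^bsub>R\<^esub> f = e \<otimes>\<^bsub>R\<^esub> g"
    using W(3) e(3) by (auto simp: R_simps fun_eq_iff)
  with e show "\<exists>e\<in>carrier R. \<gamma> e = \<one>\<^bsub>S\<^esub> \<and> e \<otimes>\<^bsub>R\<^esub> f = e \<otimes>\<^bsub>R\<^esub> g" by blast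
next
  assume "\<exists>e\<in>carrier R. \<gamma> e = \<one>\<^bsub>S\<^esub> \<and> e \<otimes>\<^bsub>R\<^esub> f = e \<otimes>\<^bsub>R\<^esub> g"
  then obtain e where e: "e \<in> carrier R" "\<gamma> e = \<one>\<^bsub>S\<^esub>" "e \<otimes>\<^bsub>R\<^esub> f = e \<otimes>\<^bsub>R\<^esub> g" by blast
  obtain W where W: "open W" "x \<in> W" "\<And>y. y \<in> W \<Longrightarrow> e y = 1"
    by (rule germ_unit_near[OF e(1,2)]) (rule that)
  show "\<gamma> f = \<gamma> g"
  proof (rule germ_cong[OF W(1,2)])
    show "f y = g y" if "y \<in> W" for y
      using fun_cong[OF e(3), of y] W(3)[OF that] by (simp add: R_simps)
  qed
qed

lemma germ_one_closed: "\<one>\<^bsub>S\<^esub> \<in> carrier S"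
proof -
  obtain e where "e \<in> carrier R" "\<gamma> e = \<one>\<^bsub>S\<^esub>"
    by (rule unit_germ_ex[OF open_UNIV UNIV_I]) (rule that)
  then show ?thesis using germ_carrier by (metis imageI)
qed

lemma germ_unit_mult:
  assumes "e \<in> carrier R" "\<gamma> e = \<one>\<^bsub>S\<^esub>" "f \<in> carrier R"
  shows "\<gamma> (e \<otimes>\<^bsub>R\<^esub> f) = \<gamma> f"
proof -
  obtain W where W: "open W" "x \<in> W" "\<And>y. y \<in> W \<Longrightarrow> e y = 1"
    by (rule germ_unit_near[OF assms(1,2)]) (rule that)
  show ?thesis
    by (rule germ_cong[OF W(1,2)]) (simp add: R_simps W(3))
qed

lemma germ_one_mult:
  assumes "s \<in> carrier S"
  shows "\<one>\<^bsub>S\<^esub> \<otimes>\<^bsub>S\<^esub> s = s"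
proof -
  obtain e where e: "e \<in> carrier R" "\<gamma> e = \<one>\<^bsub>S\<^esub>"
    by (rule unit_germ_ex[OF open_UNIV UNIV_I]) (rule that)
  obtain f where f: "f \<in> carrier R" "s = \<gamma> f" using assms germ_carrier by auto
  have "\<one>\<^bsub>S\<^esub> \<otimes>\<^bsub>S\<^esub> s = \<gamma> (e \<otimes>\<^bsub>R\<^esub> f)"
    using germ_mult[OF e(1) f(1)] by (simp add: e(2) f(2))
  then show ?thesis using germ_unit_mult[OF e f(1)] f(2) by simp
qed

lemma unit_germ_mult_closed:
  assumes "e \<in> carrier R" "\<gamma> e = \<one>\<^bsub>S\<^esub>" "f \<in> carrier R" "\<gamma> f = \<one>\<^bsub>S\<^esub>"
  shows "e \<otimes>\<^bsub>R\<^esub> f \<in> carrier R" "\<gamma> (e \<otimes>\<^bsub>R\<^esub> f) = \<one>\<^bsub>S\<^esub>"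
  using germ_unit_mult[OF assms(1,2,3)] assms R.mult_closed by simp_all

text \<open>\<gamma> maps R onto S and respects the operations, so the axioms descend from R. The
  germ of 1 is an identity and hence a local unit for every F.\<close>

lemma germ_ring_local_units: "local_units_ring S"
proof -
  have "abelian_group S"
  proof (rule abelian_groupI)
    show "\<exists>y\<in>carrier S. y \<oplus>\<^bsub>S\<^esub> s = \<zero>\<^bsub>S\<^esub>" if s: "s \<in> carrier S" for s
    proof -
      from s obtain f where "f \<in> carrier R" "s = \<gamma> f" by (auto simp: germ_carrier)
      then show ?thesis
        by (intro bexI[of _ "\<gamma> (\<ominus>\<^bsub>R\<^esub> f)"]) (simp_all add: germ_carrier germ_add germ_zero R.l_neg)
    qed
  qed (auto simp: germ_carrier germ_add germ_zero R.a_ac)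
  then show ?thesis
  proof (intro local_units_ring.intro local_units_ring_axioms.intro)
    show "\<exists>r\<in>carrier S. \<forall>a\<in>F. r \<otimes>\<^bsub>S\<^esub> a = a" if "finite F" "F \<subseteq> carrier S" for F
      using germ_one_mult germ_one_closed that by (intro bexI[of _ "\<one>\<^bsub>S\<^esub>"]) auto
    show "a \<otimes>\<^bsub>S\<^esub> b = b \<otimes>\<^bsub>S\<^esub> a" if "a \<in> carrier S" "b \<in> carrier S" for a b
      using that by (auto simp only: germ_carrier germ_mult R.mult_comm)
  qed (auto simp: germ_carrier germ_add germ_mult R.mult_closed R.mult_assoc R.distr)
qed

sublocale S: local_units_ring S
  by (rule germ_ring_local_units)

end

section \<open>The stalk of a module at x\<close>

locale stalk_module = manifold_point n A x R S + C: locally_unitary_module R C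
  for n :: nat and A :: "'m::t2_space chart set" and x :: 'm
    and R :: "('m \<Rightarrow> 'f::real_normed_field) ring" and S :: "('m \<Rightarrow> 'f) set ring"
    and C :: "('m \<Rightarrow> 'f, 'c) module"
begin

abbreviation Nx :: "'c set" where "Nx \<equiv> stalk_null n A x C"
abbreviation Cx :: "(('m \<Rightarrow> 'f) set, 'c set) module" where "Cx \<equiv> stalk n A x C"

definition q :: "'c \<Rightarrow> 'c set" where "q c = Nx +>\<^bsub>C\<^esub> c"

lemma Nx_iff: "c \<in> Nx \<longleftrightarrow> c \<in> carrier C \<and> (\<exists>f\<in>carrier R. \<gamma> f = \<one>\<^bsub>S\<^esub> \<and> f \<odot>\<^bsub>C\<^esub> c = \<zero>\<^bsub>C\<^esub>)"
  by (auto simp: stalk_null_def R_eq S_one)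

lemma Nx_smult:
  assumes "r \<in> carrier R" "c \<in> Nx"
  shows "r \<odot>\<^bsub>C\<^esub> c \<in> Nx"
proof -
  obtain f where f: "f \<in> carrier R" "\<gamma> f = \<one>\<^bsub>S\<^esub>" "f \<odot>\<^bsub>C\<^esub> c = \<zero>\<^bsub>C\<^esub>" and c: "c \<in> carrier C"
    using assms(2) by (auto simp: Nx_iff)
  have "f \<odot>\<^bsub>C\<^esub> (r \<odot>\<^bsub>C\<^esub> c) = r \<odot>\<^bsub>C\<^esub> (f \<odot>\<^bsub>C\<^esub> c)"
    using C.smult_assoc[of f r c] C.smult_assoc[of r f c] R.mult_comm[of f r] f(1) c assms(1) by simp
  then show ?thesis
    using f c assms(1) C.smult_closed C.smult_r_zero[OF assms(1)] by (auto simp: Nx_iff)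
qed

text \<open>If f kills c and g kills d, then f g kills both, hence the sum, and its germ is again 1.
  Zero belongs to Nx because some element of R has germ 1.\<close>

lemma Nx_abelian_subgroup: "abelian_subgroup Nx C"
proof (rule abelian_subgroupI3[OF additive_subgroupI C.M.abelian_group_axioms], rule subgroup.intro)
  show "Nx \<subseteq> carrier (add_monoid C)" by (auto simp: Nx_iff)
  show "\<one>\<^bsub>add_monoid C\<^esub> \<in> Nx"
  proof -
    obtain e where "e \<in> carrier R" "\<gamma> e = \<one>\<^bsub>S\<^esub>"
      by (rule unit_germ_ex[OF open_UNIV UNIV_I]) (rule that)
    then show ?thesis using C.smult_r_zero by (auto simp: Nx_iff)
  qed
  show "c \<otimes>\<^bsub>add_monoid C\<^esub> d \<in> Nx" if cN: "c \<in> Nx" and dN: "d \<in> Nx" for c d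
  proof -
    obtain f where f: "f \<in> carrier R" "\<gamma> f = \<one>\<^bsub>S\<^esub>" "f \<odot>\<^bsub>C\<^esub> c = \<zero>\<^bsub>C\<^esub>" and c: "c \<in> carrier C"
      using cN by (auto simp: Nx_iff)
    obtain g where g: "g \<in> carrier R" "\<gamma> g = \<one>\<^bsub>S\<^esub>" "g \<odot>\<^bsub>C\<^esub> d = \<zero>\<^bsub>C\<^esub>" and d: "d \<in> carrier C"
      using dN by (auto simp: Nx_iff)
    have "(f \<otimes>\<^bsub>R\<^esub> g) \<odot>\<^bsub>C\<^esub> c = (g \<otimes>\<^bsub>R\<^esub> f) \<odot>\<^bsub>C\<^esub> c"
      using f g by (simp add: R.mult_comm[of f g])
    then have "(f \<otimes>\<^bsub>R\<^esub> g) \<odot>\<^bsub>C\<^esub> c = \<zero>\<^bsub>C\<^esub>"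
      using f g c C.smult_r_zero by (simp add: C.smult_assoc)
    moreover have "(f \<otimes>\<^bsub>R\<^esub> g) \<odot>\<^bsub>C\<^esub> d = \<zero>\<^bsub>C\<^esub>"
      using f g d C.smult_r_zero by (simp add: C.smult_assoc)
    ultimately have "(f \<otimes>\<^bsub>R\<^esub> g) \<odot>\<^bsub>C\<^esub> (c \<oplus>\<^bsub>C\<^esub> d) = \<zero>\<^bsub>C\<^esub>"
      using f g c d by (simp add: C.smult_r_distr R.mult_closed)
    then show ?thesis
      using unit_germ_mult_closed[OF f(1,2) g(1,2)] c d by (auto simp: Nx_iff)
  qed
  show "inv\<^bsub>add_monoid C\<^esub> c \<in> Nx" if cN: "c \<in> Nx" for c
  proof -
    obtain f where f: "f \<in> carrier R" "\<gamma> f = \<one>\<^bsub>S\<^esub>" "f \<odot>\<^bsub>C\<^esub> c = \<zero>\<^bsub>C\<^esub>" and c: "c \<in> carrier C"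
      using cN by (auto simp: Nx_iff)
    then have "\<ominus>\<^bsub>C\<^esub> c \<in> Nx"
      using C.smult_r_minus[OF f(1) c] by (auto simp: Nx_iff)
    then show ?thesis by (simp add: a_inv_def)
  qed
qed

sublocale Nx: abelian_subgroup Nx C
  by (rule Nx_abelian_subgroup)

lemma Cx_simps: "add Cx = set_add C" "zero Cx = Nx"
  by (simp_all add: stalk_def)

lemma Cx_carrier: "carrier Cx = q ` carrier C"
  by (auto simp: stalk_def A_RCOSETS_def' q_def)

lemma q_closed: "c \<in> carrier C \<Longrightarrow> q c \<in> carrier Cx"
  by (simp add: Cx_carrier)

lemma q_self: "c \<in> carrier C \<Longrightarrow> c \<in> q c"
  unfolding q_def by (rule Nx.a_rcos_self)

lemma q_memD:
  assumes "c \<in> carrier C" "d \<in> q c"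
  shows "d \<in> carrier C" "q d = q c"
  using assms C.M.a_r_coset_subset_G[OF Nx.a_subset, of c] Nx.a_repr_independence'[of d c]
  by (auto simp: q_def)

lemma q_add: "c \<in> carrier C \<Longrightarrow> d \<in> carrier C \<Longrightarrow> q c \<oplus>\<^bsub>Cx\<^esub> q d = q (c \<oplus>\<^bsub>C\<^esub> d)"
  unfolding q_def Cx_simps by (rule Nx.a_rcos_sum)

lemma q_zero: "\<zero>\<^bsub>Cx\<^esub> = q \<zero>\<^bsub>C\<^esub>"
  unfolding q_def Cx_simps by (simp add: C.M.a_coset_add_zero[OF Nx.a_subset])

lemma q_eq_zero_iff:
  assumes "c \<in> carrier C"
  shows "q c = \<zero>\<^bsub>Cx\<^esub> \<longleftrightarrow> c \<in> Nx"
proof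
  assume "q c = \<zero>\<^bsub>Cx\<^esub>"
  then show "c \<in> Nx" using q_self[OF assms] by (simp add: Cx_simps)
next
  assume "c \<in> Nx"
  then show "q c = \<zero>\<^bsub>Cx\<^esub>"
    unfolding q_def Cx_simps by (rule C.M.a_coset_join2[OF assms Nx.a_subgroup])
qed

lemma Cx_abelian_group: "abelian_group Cx"
proof (rule abelian_groupI)
  show "\<exists>Y\<in>carrier Cx. Y \<oplus>\<^bsub>Cx\<^esub> X = \<zero>\<^bsub>Cx\<^esub>" if "X \<in> carrier Cx" for X
  proof -
    from that obtain c where "c \<in> carrier C" "X = q c" by (auto simp: Cx_carrier)
    then show ?thesis
      by (intro bexI[of _ "q (\<ominus>\<^bsub>C\<^esub> c)"]) (simp_all add: q_add q_closed q_zero C.M.l_neg)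
  qed
qed (auto simp: Cx_carrier q_add q_zero C.M.a_ac)

text \<open>The action of R on C_x depends on germs only: with e f = e g and e of germ 1, e
  annihilates the difference of f c and g c, which thus lies in Nx.\<close>

lemma q_smult_cong:
  assumes "f \<in> carrier R" "g \<in> carrier R" "\<gamma> f = \<gamma> g" "c \<in> carrier C"
  shows "q (f \<odot>\<^bsub>C\<^esub> c) = q (g \<odot>\<^bsub>C\<^esub> c)"
proof -
  obtain e where e: "e \<in> carrier R" "\<gamma> e = \<one>\<^bsub>S\<^esub>" "e \<otimes>\<^bsub>R\<^esub> f = e \<otimes>\<^bsub>R\<^esub> g"
    using germ_eq_iff assms by auto
  define d where "d = f \<odot>\<^bsub>C\<^esub> c \<oplus>\<^bsub>C\<^esub> \<ominus>\<^bsub>C\<^esub> (g \<odot>\<^bsub>C\<^esub> c)"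
  have fc: "f \<odot>\<^bsub>C\<^esub> c \<in> carrier C" "g \<odot>\<^bsub>C\<^esub> c \<in> carrier C"
    using assms C.smult_closed by auto
  have d: "d \<in> carrier C" using fc by (simp add: d_def)
  have eq: "e \<odot>\<^bsub>C\<^esub> (f \<odot>\<^bsub>C\<^esub> c) = e \<odot>\<^bsub>C\<^esub> (g \<odot>\<^bsub>C\<^esub> c)"
    using C.smult_assoc[of e f c] C.smult_assoc[of e g c] e assms by simp
  have "e \<odot>\<^bsub>C\<^esub> d = \<zero>\<^bsub>C\<^esub>"
    using e(1) fc by (simp add: d_def C.smult_r_distr C.smult_r_minus eq C.M.r_neg C.smult_closed)
  then have "d \<in> Nx" using d e by (auto simp: Nx_iff)
  then have "q d = \<zero>\<^bsub>Cx\<^esub>" using q_eq_zero_iff d by blast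
  moreover have "q (f \<odot>\<^bsub>C\<^esub> c) = q d \<oplus>\<^bsub>Cx\<^esub> q (g \<odot>\<^bsub>C\<^esub> c)"
    using d fc by (simp add: q_add d_def C.M.a_assoc C.M.l_neg)
  ultimately show ?thesis
    using abelian_monoid.l_zero[OF abelian_group.axioms(1)[OF Cx_abelian_group] q_closed[OF fc(2)]] by simp
qed

lemma q_smult_eq:
  assumes "f \<in> carrier R" "c \<in> carrier C" "d \<in> q c"
  shows "q (f \<odot>\<^bsub>C\<^esub> d) = q (f \<odot>\<^bsub>C\<^esub> c)"
proof -
  obtain z where z: "z \<in> Nx" "d = z \<oplus>\<^bsub>C\<^esub> c"
    using assms(3) by (auto simp: q_def a_r_coset_def')
  then have zC: "z \<in> carrier C" by (simp add: Nx_iff)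
  have "q (f \<odot>\<^bsub>C\<^esub> d) = q (f \<odot>\<^bsub>C\<^esub> z) \<oplus>\<^bsub>Cx\<^esub> q (f \<odot>\<^bsub>C\<^esub> c)"
    using z zC assms by (simp add: C.smult_r_distr q_add C.smult_closed)
  also have "q (f \<odot>\<^bsub>C\<^esub> z) = \<zero>\<^bsub>Cx\<^esub>"
    using q_eq_zero_iff[of "f \<odot>\<^bsub>C\<^esub> z"] Nx_smult[OF assms(1) z(1)] by (simp add: Nx_iff)
  finally show ?thesis
    using abelian_monoid.l_zero[OF abelian_group.axioms(1)[OF Cx_abelian_group] q_closed] assms
      C.smult_closed by simp
qed

text \<open>All sets in the defining union coincide: \<open>q_smult_cong\<close> deals with the
  function representing the germ, \<open>q_smult_eq\<close> with the element representing the
  class.\<close>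

lemma Cx_smult:
  assumes "f \<in> carrier R" "c \<in> carrier C"
  shows "\<gamma> f \<odot>\<^bsub>Cx\<^esub> q c = q (f \<odot>\<^bsub>C\<^esub> c)"
proof -
  have "q (g \<odot>\<^bsub>C\<^esub> d) = q (f \<odot>\<^bsub>C\<^esub> c)" if "g \<in> \<gamma> f \<inter> carrier R" "d \<in> q c" for g d
    using that q_smult_eq[of g c d] assms q_smult_cong[of g f c] germ_mem_eq[of g f] by simp
  moreover have "f \<in> \<gamma> f \<inter> carrier R"
    using assms(1) R_germ_self by simp
  ultimately have "(\<Union>g\<in>\<gamma> f \<inter> carrier R. \<Union>d\<in>q c. q (g \<odot>\<^bsub>C\<^esub> d)) = q (f \<odot>\<^bsub>C\<^esub> c)"
    using q_self[OF assms(2)] by (intro UN_UN_const)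
  then show ?thesis by (simp add: stalk_def R_eq[symmetric] q_def)
qed

text \<open>In C itself e c and c may differ. But c = r c for some r in R, and e r has the same germ
  as r.\<close>

lemma unit_smult:
  assumes "e \<in> carrier R" "\<gamma> e = \<one>\<^bsub>S\<^esub>" "c \<in> carrier C"
  shows "q (e \<odot>\<^bsub>C\<^esub> c) = q c"
proof -
  obtain r where r: "r \<in> carrier R" "r \<odot>\<^bsub>C\<^esub> c = c"
    using C.locally_unitary[of "{c}"] assms(3) by auto
  have "q ((e \<otimes>\<^bsub>R\<^esub> r) \<odot>\<^bsub>C\<^esub> c) = q (r \<odot>\<^bsub>C\<^esub> c)"
    by (rule q_smult_cong) (use assms r germ_unit_mult R.mult_closed in auto)
  then show ?thesis using r assms by (simp add: C.smult_assoc)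
qed

lemma stalk_locally_unitary: "locally_unitary_module S Cx"
proof (intro locally_unitary_module.intro locally_unitary_module_axioms.intro
    S.local_units_ring_axioms Cx_abelian_group)
  obtain e where e: "e \<in> carrier R" "\<gamma> e = \<one>\<^bsub>S\<^esub>"
    by (rule unit_germ_ex[OF open_UNIV UNIV_I]) (rule that)
  show "\<exists>r\<in>carrier S. \<forall>X\<in>F. r \<odot>\<^bsub>Cx\<^esub> X = X" if F: "F \<subseteq> carrier Cx" for F
  proof (rule bexI[of _ "\<gamma> e"])
    show "\<forall>X\<in>F. \<gamma> e \<odot>\<^bsub>Cx\<^esub> X = X"
    proof
      fix X assume "X \<in> F"
      then obtain c where c: "c \<in> carrier C" "X = q c" using F Cx_carrier by auto
      then show "\<gamma> e \<odot>\<^bsub>Cx\<^esub> X = X" using Cx_smult[OF e(1) c(1)] unit_smult[OF e c(1)] by simp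
    qed
    show "\<gamma> e \<in> carrier S" unfolding germ_carrier by (rule imageI[OF e(1)])
  qed
qed (auto simp: germ_carrier Cx_carrier Cx_smult q_add germ_add germ_mult C.smult_closed
    R.mult_closed C.smult_l_distr C.smult_r_distr C.smult_assoc)

lemma q_hom: "q \<in> hom (add_monoid C) (add_monoid Cx)"
  by (rule hom_addI) (simp_all add: q_closed q_add)

lemma UN_coset_eq:
  assumes "c \<in> carrier C" "\<And>d. d \<in> q c \<Longrightarrow> F d = F c"
  shows "(\<Union>d\<in>q c. F d) = F c"
  using q_self[OF assms(1)] assms(2) by blast

end

text \<open>If f kills z, then f \<alpha>(z) = \<alpha>(f z) = 0. Therefore \<alpha> maps the null
  submodule of C into that of D, and all cosets in the union defining \<open>stalk_map\<close> are
  equal.\<close>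

lemma (in manifold_point) stalk_map_q:
  assumes C: "stalk_module n A x R S C" and D: "stalk_module n A x R S D"
    and \<alpha>: "\<alpha> \<in> linear_maps R C D" and c: "c \<in> carrier C"
  shows "stalk_map n A x D \<alpha> (stalk_module.q n A x C c) = stalk_module.q n A x D (\<alpha> c)"
proof -
  interpret C: stalk_module n A x R S C by (rule C)
  interpret D: stalk_module n A x R S D by (rule D)
  note \<alpha> = linear_mapsD[OF \<alpha>]
  have null: "\<alpha> z \<in> D.Nx" if "z \<in> C.Nx" for z
  proof -
    obtain f where f: "f \<in> carrier R" "\<gamma> f = \<one>\<^bsub>S\<^esub>" "f \<odot>\<^bsub>C\<^esub> z = \<zero>\<^bsub>C\<^esub>" and z: "z \<in> carrier C"
      using \<open>z \<in> C.Nx\<close> by (auto simp: C.Nx_iff)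
    have "\<alpha> \<zero>\<^bsub>C\<^esub> = \<zero>\<^bsub>D\<^esub>"
      using \<alpha>(2)[of "\<zero>\<^bsub>C\<^esub>" "\<zero>\<^bsub>C\<^esub>"] \<alpha>(1)[of "\<zero>\<^bsub>C\<^esub>"] by (simp add: D.C.M.add.r_cancel_one')
    then have "f \<odot>\<^bsub>D\<^esub> \<alpha> z = \<zero>\<^bsub>D\<^esub>" using \<alpha>(3)[OF f(1) z] f(3) by simp
    then show ?thesis using f z \<alpha>(1) by (auto simp: D.Nx_iff)
  qed
  have "D.q (\<alpha> d) = D.q (\<alpha> c)" if d: "d \<in> C.q c" for d
  proof -
    obtain z where z: "z \<in> C.Nx" "d = z \<oplus>\<^bsub>C\<^esub> c"
      using d by (auto simp: C.q_def a_r_coset_def')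
    then have "\<alpha> d \<in> D.q (\<alpha> c)"
      using null[OF z(1)] \<alpha>(2)[of z c] c by (auto simp: D.q_def a_r_coset_def' C.Nx_iff)
    then show ?thesis using D.q_memD \<alpha>(1)[OF c] by blast
  qed
  then show ?thesis
    using C.UN_coset_eq[OF c, of "\<lambda>d. D.q (\<alpha> d)"] by (simp add: stalk_map_def D.q_def)
qed

section \<open>Stalks of coalgebras\<close>

context stalk_module
begin

section \<open>The canonical map to the tensor product of stalks\<close>

abbreviation CC :: "('m \<Rightarrow> 'f, ('c \<times> 'c \<Rightarrow>\<^sub>0 int) set) module"
  where "CC \<equiv> tensor_product R C C"

abbreviation CCx :: "(('m \<Rightarrow> 'f) set, ('c set \<times> 'c set \<Rightarrow>\<^sub>0 int) set) module"
  where "CCx \<equiv> tensor_product S Cx Cx"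

lemma tensor_pair: "module_pair R C C"
  by (intro module_pair.intro C.locally_unitary_module_axioms)

lemma stalk_tensor_pair: "module_pair S Cx Cx"
  by (intro module_pair.intro stalk_locally_unitary)

lemma tensor_stalk_module: "stalk_module n A x R S CC"
  by (intro stalk_module.intro manifold_point_axioms module_pair.tensor_locally_unitary[OF tensor_pair])

lemma regular_stalk_module: "stalk_module n A x R S (regular_module R)"
  by (intro stalk_module.intro manifold_point_axioms R.regular_module_locally_unitary)

text \<open>This is the lift inside \<open>stalk_tensor\<close>, taken before an element is chosen
  from a class in the stalk of C \<otimes> C.\<close>

definition \<tau> :: "('c \<times> 'c \<Rightarrow>\<^sub>0 int) set \<Rightarrow> ('c set \<times> 'c set \<Rightarrow>\<^sub>0 int) set"
  where "\<tau> = tensor_lift CCx (\<lambda>c c'. pure_tensor S Cx Cx (q c) (q c'))"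

text \<open>Balance for r in R is balance over S for the germ of r, since q (r c) is that germ
  acting on q c.\<close>

lemma \<tau>_balanced: "balanced_map R C C CCx (\<lambda>c c'. pure_tensor S Cx Cx (q c) (q c'))"
proof (intro balanced_map.intro balanced_map_axioms.intro tensor_pair
    module_pair.tensor_abelian_group[OF stalk_tensor_pair])
  note pair = stalk_tensor_pair
  show "pure_tensor S Cx Cx (q c) (q c') \<in> carrier CCx" if "c \<in> carrier C" "c' \<in> carrier C" for c c'
    using that by (simp add: module_pair.pure_closed[OF pair] q_closed)
  show "pure_tensor S Cx Cx (q (c \<oplus>\<^bsub>C\<^esub> c')) (q d) =
      pure_tensor S Cx Cx (q c) (q d) \<oplus>\<^bsub>CCx\<^esub> pure_tensor S Cx Cx (q c') (q d)"
    if "c \<in> carrier C" "c' \<in> carrier C" "d \<in> carrier C" for c c' d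
    using that module_pair.pure_add_left[OF pair, of "q c" "q c'" "q d"] by (simp add: q_closed q_add)
  show "pure_tensor S Cx Cx (q c) (q (d \<oplus>\<^bsub>C\<^esub> d')) =
      pure_tensor S Cx Cx (q c) (q d) \<oplus>\<^bsub>CCx\<^esub> pure_tensor S Cx Cx (q c) (q d')"
    if "c \<in> carrier C" "d \<in> carrier C" "d' \<in> carrier C" for c d d'
    using that module_pair.pure_add_right[OF pair, of "q c" "q d" "q d'"] by (simp add: q_closed q_add)
  show "pure_tensor S Cx Cx (q (r \<odot>\<^bsub>C\<^esub> c)) (q d) = pure_tensor S Cx Cx (q c) (q (r \<odot>\<^bsub>C\<^esub> d))"
    if "r \<in> carrier R" "c \<in> carrier C" "d \<in> carrier C" for r c d
    using that module_pair.pure_balanced[OF pair, of "\<gamma> r" "q c" "q d"]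
    by (simp add: q_closed Cx_smult germ_carrier)
qed

lemma \<tau>_hom: "\<tau> \<in> hom (add_monoid CC) (add_monoid CCx)"
  unfolding \<tau>_def by (rule balanced_map.tensor_lift_hom[OF \<tau>_balanced])

lemma \<tau>_pure:
  "c \<in> carrier C \<Longrightarrow> d \<in> carrier C \<Longrightarrow> \<tau> (pure_tensor R C C c d) = pure_tensor S Cx Cx (q c) (q d)"
  unfolding \<tau>_def by (rule balanced_map.tensor_lift_pure[OF \<tau>_balanced])

lemmas \<tau>_closed = hom_addD(1)[OF \<tau>_hom]
lemmas \<tau>_add = hom_addD(2)[OF \<tau>_hom]

text \<open>Semilinearity along \<gamma>, the form in which linearity over R survives the change of
  rings.\<close>

lemma \<tau>_smult:
  assumes f: "f \<in> carrier R" and t: "t \<in> carrier CC"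
  shows "\<tau> (f \<odot>\<^bsub>CC\<^esub> t) = \<gamma> f \<odot>\<^bsub>CCx\<^esub> \<tau> t"
  using t
proof (induction rule: module_pair.tensor_induct[OF tensor_pair, consumes 1, case_names pure add])
  case (pure c d)
  then show ?case
    using f module_pair.tensor_smult_pure[OF stalk_tensor_pair, of "\<gamma> f" "q c" "q d"]
    by (simp add: module_pair.tensor_smult_pure[OF tensor_pair] \<tau>_pure C.smult_closed
        Cx_smult q_closed germ_carrier)
next
  case (add t u)
  then show ?case
    using f module_pair.tensor_smult_add[OF stalk_tensor_pair, of "\<gamma> f" "\<tau> t" "\<tau> u"]
    by (simp add: module_pair.tensor_smult_add[OF tensor_pair]
        module_pair.tensor_smult_closed[OF tensor_pair] \<tau>_add \<tau>_closed germ_carrier)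
qed

lemma \<tau>_null:
  assumes "t \<in> stalk_null n A x CC"
  shows "\<tau> t = \<zero>\<^bsub>CCx\<^esub>"
proof -
  interpret CCx: locally_unitary_module S CCx
    by (rule module_pair.tensor_locally_unitary[OF stalk_tensor_pair])
  interpret T: abelian_group CC
    by (rule module_pair.tensor_abelian_group[OF tensor_pair])
  obtain f where f: "f \<in> carrier R" "\<gamma> f = \<one>\<^bsub>S\<^esub>" "f \<odot>\<^bsub>CC\<^esub> t = \<zero>\<^bsub>CC\<^esub>" and t: "t \<in> carrier CC"
    using assms by (auto simp: stalk_module.Nx_iff[OF tensor_stalk_module])
  have "\<tau> \<zero>\<^bsub>CC\<^esub> = \<zero>\<^bsub>CCx\<^esub>"
    using \<tau>_add[of "\<zero>\<^bsub>CC\<^esub>" "\<zero>\<^bsub>CC\<^esub>"] \<tau>_closed[of "\<zero>\<^bsub>CC\<^esub>"]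
    by (simp add: CCx.M.add.r_cancel_one')
  then have "\<one>\<^bsub>S\<^esub> \<odot>\<^bsub>CCx\<^esub> \<tau> t = \<zero>\<^bsub>CCx\<^esub>"
    using \<tau>_smult[OF f(1) t] f by simp
  \<comment> \<open>The germ of 1 acts as the identity because the target is locally unitary over
    S.\<close>
  then show ?thesis
    using CCx.one_smult[OF germ_one_closed germ_one_mult \<tau>_closed[OF t]] by simp
qed

text \<open>The chosen element differs from t by an element of the null submodule of C \<otimes> C,
  which \<tau> kills.\<close>

lemma stalk_tensor_q:
  assumes t: "t \<in> carrier CC"
  shows "stalk_tensor n A x C (stalk_module.q n A x CC t) = \<tau> t"
proof -
  interpret T: stalk_module n A x R S CC by (rule tensor_stalk_module)
  interpret CCx: abelian_group CCx
    by (rule module_pair.tensor_abelian_group[OF stalk_tensor_pair])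
  define u where "u = (SOME u. u \<in> T.q t)"
  have "u \<in> T.q t"
    unfolding u_def by (rule someI[of "\<lambda>u. u \<in> T.q t"]) (rule T.q_self[OF t])
  then obtain z where z: "z \<in> T.Nx" "u = z \<oplus>\<^bsub>CC\<^esub> t"
    by (auto simp: T.q_def a_r_coset_def')
  then have "\<tau> u = \<tau> t"
    using \<tau>_add[of z t] \<tau>_null[OF z(1)] t \<tau>_closed[OF t] by (simp add: T.Nx_iff)
  then show ?thesis
    unfolding stalk_tensor_def Let_def S_eq[symmetric] q_def[symmetric] \<tau>_def[symmetric] u_def .
qed

lemma stalk_comult_q:
  assumes \<Delta>: "\<Delta> \<in> linear_maps R C CC" and c: "c \<in> carrier C"
  shows "stalk_comult n A x C \<Delta> (q c) = \<tau> (\<Delta> c)"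
  using stalk_map_q[OF stalk_module_axioms tensor_stalk_module \<Delta> c]
    stalk_tensor_q[OF linear_mapsD(1)[OF \<Delta> c]]
  by (simp add: stalk_comult_def R_eq)

lemma stalk_counit_q:
  assumes \<epsilon>: "\<epsilon> \<in> linear_maps R C (regular_module R)" and c: "c \<in> carrier C"
  shows "stalk_counit n A x \<epsilon> (q c) = \<gamma> (\<epsilon> c)"
proof -
  interpret RM: stalk_module n A x R S "regular_module R" by (rule regular_stalk_module)
  have \<epsilon>c: "\<epsilon> c \<in> carrier R" using linear_mapsD(1)[OF \<epsilon> c] by simp
  \<comment> \<open>All members of the coset have one germ: f differs from \<epsilon> c by some z
    with e z = 0 and e of germ 1, so f and \<epsilon> c agree after multiplication by e.\<close>
  have "\<gamma> f = \<gamma> (\<epsilon> c)" if f: "f \<in> RM.q (\<epsilon> c)" for f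
  proof -
    have fR: "f \<in> carrier R"
      using RM.q_memD(1)[OF _ f] \<epsilon>c by simp
    obtain z where z: "z \<in> RM.Nx" "f = z \<oplus>\<^bsub>R\<^esub> \<epsilon> c"
      using f by (auto simp: RM.q_def a_r_coset_def')
    then obtain e where e: "e \<in> carrier R" "\<gamma> e = \<one>\<^bsub>S\<^esub>" "e \<otimes>\<^bsub>R\<^esub> z = \<zero>\<^bsub>R\<^esub>" and zR: "z \<in> carrier R"
      by (auto simp: RM.Nx_iff)
    have "e \<otimes>\<^bsub>R\<^esub> f = e \<otimes>\<^bsub>R\<^esub> \<epsilon> c"
      using RM.C.smult_r_distr[of e z "\<epsilon> c"] e zR \<epsilon>c z(2) R.mult_closed by simp
    then show ?thesis
      using germ_eq_iff[OF fR \<epsilon>c] e by blast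
  qed
  then have "(\<Union>f\<in>RM.q (\<epsilon> c). \<gamma> f) = \<gamma> (\<epsilon> c)"
    using \<epsilon>c by (intro RM.UN_coset_eq) simp_all
  then show ?thesis
    using stalk_map_q[OF stalk_module_axioms regular_stalk_module \<epsilon> c]
    by (simp add: stalk_counit_def stalk_to_germ_def R_eq)
qed

section \<open>The coalgebra structure on the stalk\<close>

lemma stalk_comult_linear:
  assumes \<Delta>: "\<Delta> \<in> linear_maps R C CC"
  shows "stalk_comult n A x C \<Delta> \<in> linear_maps S Cx CCx"
proof (rule linear_mapsI)
  note \<Delta>' = linear_mapsD[OF \<Delta>]
  show "stalk_comult n A x C \<Delta> X \<in> carrier CCx" if X: "X \<in> carrier Cx" for X
    using X by (auto simp: Cx_carrier stalk_comult_q[OF \<Delta>] \<tau>_closed \<Delta>')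
  show "stalk_comult n A x C \<Delta> (X \<oplus>\<^bsub>Cx\<^esub> Y) =
      stalk_comult n A x C \<Delta> X \<oplus>\<^bsub>CCx\<^esub> stalk_comult n A x C \<Delta> Y"
    if "X \<in> carrier Cx" "Y \<in> carrier Cx" for X Y
    using that by (auto simp: Cx_carrier stalk_comult_q[OF \<Delta>] \<tau>_add \<Delta>' q_add)
  show "stalk_comult n A x C \<Delta> (s \<odot>\<^bsub>Cx\<^esub> X) = s \<odot>\<^bsub>CCx\<^esub> stalk_comult n A x C \<Delta> X"
    if "s \<in> carrier S" "X \<in> carrier Cx" for s X
    using that
    by (auto simp: Cx_carrier germ_carrier stalk_comult_q[OF \<Delta>] \<tau>_smult \<Delta>' Cx_smult C.smult_closed)
qed

lemma stalk_counit_linear: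
  assumes \<epsilon>: "\<epsilon> \<in> linear_maps R C (regular_module R)"
  shows "stalk_counit n A x \<epsilon> \<in> linear_maps S Cx (regular_module S)"
proof (rule linear_mapsI)
  note \<epsilon>' = linear_mapsD[OF \<epsilon>, simplified]
  show "stalk_counit n A x \<epsilon> X \<in> carrier (regular_module S)" if X: "X \<in> carrier Cx" for X
    using X by (auto simp: Cx_carrier stalk_counit_q[OF \<epsilon>] \<epsilon>' germ_carrier)
  show "stalk_counit n A x \<epsilon> (X \<oplus>\<^bsub>Cx\<^esub> Y) =
      stalk_counit n A x \<epsilon> X \<oplus>\<^bsub>regular_module S\<^esub> stalk_counit n A x \<epsilon> Y"
    if "X \<in> carrier Cx" "Y \<in> carrier Cx" for X Y
    using that by (auto simp: Cx_carrier stalk_counit_q[OF \<epsilon>] germ_add \<epsilon>' q_add)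
  show "stalk_counit n A x \<epsilon> (s \<odot>\<^bsub>Cx\<^esub> X) = s \<odot>\<^bsub>regular_module S\<^esub> stalk_counit n A x \<epsilon> X"
    if "s \<in> carrier S" "X \<in> carrier Cx" for s X
    using that
    by (auto simp: Cx_carrier germ_carrier stalk_counit_q[OF \<epsilon>] germ_mult \<epsilon>' Cx_smult C.smult_closed)
qed

lemma stalk_coalgebra:
  assumes "coalgebra R C \<Delta> \<epsilon>"
  shows "coalgebra S Cx (stalk_comult n A x C \<Delta>) (stalk_counit n A x \<epsilon>)"
proof -
  interpret K: coalgebra R C \<Delta> \<epsilon> by (rule assms)
  let ?\<Delta> = "stalk_comult n A x C \<Delta>" and ?\<epsilon> = "stalk_counit n A x \<epsilon>"
  note \<Delta> = K.comult_linear and \<epsilon> = K.counit_linear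
  note \<Delta>x = stalk_comult_linear[OF \<Delta>] and \<epsilon>x = stalk_counit_linear[OF \<epsilon>]
  note C_mod = C.locally_unitary_module_axioms and R_mod = R.regular_module_locally_unitary
    and Cx_mod = stalk_locally_unitary and S_mod = S.regular_module_locally_unitary
  interpret Cx: locally_unitary_module S Cx by (rule Cx_mod)
  \<comment> \<open>On c \<otimes> d both sides are the class of \<epsilon>(d) c, because the germ
    of \<epsilon>(d) acts on q c as \<epsilon>(d) acts on c. At t = \<Delta> c the right-hand side
    is q c by the counit axiom of C.\<close>
  have right: "tensor_lift Cx (\<lambda>X s. s \<odot>\<^bsub>Cx\<^esub> X) (tensor_map S Cx (regular_module S) id ?\<epsilon> (\<tau> t)) =
      q (tensor_lift C (\<lambda>c r. r \<odot>\<^bsub>C\<^esub> c) (tensor_map R C (regular_module R) id \<epsilon> t))"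
    if "t \<in> carrier CC" for t
    using _ _ _ that
  proof (rule module_pair.tensor_hom_eqI[OF tensor_pair])
    show "(\<lambda>t. tensor_lift Cx (\<lambda>X s. s \<odot>\<^bsub>Cx\<^esub> X) (tensor_map S Cx (regular_module S) id ?\<epsilon> (\<tau> t)))
        \<in> hom (add_monoid CC) (add_monoid Cx)"
      by (rule hom_add_comp[OF hom_add_comp[OF \<tau>_hom
              tensor_map_hom[OF Cx_mod Cx_mod Cx_mod S_mod id_linear \<epsilon>x]]
            balanced_map.tensor_lift_hom[OF Cx.right_action_balanced]])
    show "(\<lambda>t. q (tensor_lift C (\<lambda>c r. r \<odot>\<^bsub>C\<^esub> c) (tensor_map R C (regular_module R) id \<epsilon> t)))
        \<in> hom (add_monoid CC) (add_monoid Cx)"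
      by (rule hom_add_comp[OF hom_add_comp[OF
              tensor_map_hom[OF C_mod C_mod C_mod R_mod id_linear \<epsilon>]
              balanced_map.tensor_lift_hom[OF C.right_action_balanced]] q_hom])
    fix c d assume cd: "c \<in> carrier C" "d \<in> carrier C"
    have \<epsilon>d: "\<epsilon> d \<in> carrier R" using linear_mapsD(1)[OF \<epsilon> cd(2)] by simp
    show "tensor_lift Cx (\<lambda>X s. s \<odot>\<^bsub>Cx\<^esub> X)
        (tensor_map S Cx (regular_module S) id ?\<epsilon> (\<tau> (pure_tensor R C C c d))) =
      q (tensor_lift C (\<lambda>c r. r \<odot>\<^bsub>C\<^esub> c)
        (tensor_map R C (regular_module R) id \<epsilon> (pure_tensor R C C c d)))"
      using cd \<epsilon>d
      by (simp add: \<tau>_pure tensor_map_pure[OF Cx_mod Cx_mod Cx_mod S_mod id_linear \<epsilon>x] q_closed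
          tensor_map_pure[OF C_mod C_mod C_mod R_mod id_linear \<epsilon>] stalk_counit_q[OF \<epsilon>]
          balanced_map.tensor_lift_pure[OF Cx.right_action_balanced]
          balanced_map.tensor_lift_pure[OF C.right_action_balanced] germ_carrier Cx_smult)
  qed
  \<comment> \<open>Mirror image: on c \<otimes> d both sides are the class of \<epsilon>(c)
    d.\<close>
  have left: "tensor_lift Cx (\<lambda>s X. s \<odot>\<^bsub>Cx\<^esub> X) (tensor_map S (regular_module S) Cx ?\<epsilon> id (\<tau> t)) =
      q (tensor_lift C (\<lambda>r c. r \<odot>\<^bsub>C\<^esub> c) (tensor_map R (regular_module R) C \<epsilon> id t))"
    if "t \<in> carrier CC" for t
    using _ _ _ that
  proof (rule module_pair.tensor_hom_eqI[OF tensor_pair])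
    show "(\<lambda>t. tensor_lift Cx (\<lambda>s X. s \<odot>\<^bsub>Cx\<^esub> X) (tensor_map S (regular_module S) Cx ?\<epsilon> id (\<tau> t)))
        \<in> hom (add_monoid CC) (add_monoid Cx)"
      by (rule hom_add_comp[OF hom_add_comp[OF \<tau>_hom
              tensor_map_hom[OF Cx_mod Cx_mod S_mod Cx_mod \<epsilon>x id_linear]]
            balanced_map.tensor_lift_hom[OF Cx.left_action_balanced]])
    show "(\<lambda>t. q (tensor_lift C (\<lambda>r c. r \<odot>\<^bsub>C\<^esub> c) (tensor_map R (regular_module R) C \<epsilon> id t)))
        \<in> hom (add_monoid CC) (add_monoid Cx)"
      by (rule hom_add_comp[OF hom_add_comp[OF
              tensor_map_hom[OF C_mod C_mod R_mod C_mod \<epsilon> id_linear]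
              balanced_map.tensor_lift_hom[OF C.left_action_balanced]] q_hom])
    fix c d assume cd: "c \<in> carrier C" "d \<in> carrier C"
    have \<epsilon>c: "\<epsilon> c \<in> carrier R" using linear_mapsD(1)[OF \<epsilon> cd(1)] by simp
    show "tensor_lift Cx (\<lambda>s X. s \<odot>\<^bsub>Cx\<^esub> X)
        (tensor_map S (regular_module S) Cx ?\<epsilon> id (\<tau> (pure_tensor R C C c d))) =
      q (tensor_lift C (\<lambda>r c. r \<odot>\<^bsub>C\<^esub> c)
        (tensor_map R (regular_module R) C \<epsilon> id (pure_tensor R C C c d)))"
      using cd \<epsilon>c
      by (simp add: \<tau>_pure tensor_map_pure[OF Cx_mod Cx_mod S_mod Cx_mod \<epsilon>x id_linear] q_closed
          tensor_map_pure[OF C_mod C_mod R_mod C_mod \<epsilon> id_linear] stalk_counit_q[OF \<epsilon>]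
          balanced_map.tensor_lift_pure[OF Cx.left_action_balanced]
          balanced_map.tensor_lift_pure[OF C.left_action_balanced] germ_carrier Cx_smult)
  qed
  show ?thesis
  proof (intro coalgebra.intro coalgebra_axioms.intro Cx_mod \<Delta>x \<epsilon>x)
    fix X assume "X \<in> carrier Cx"
    then obtain c where c: "c \<in> carrier C" "X = q c" by (auto simp: Cx_carrier)
    have \<Delta>c: "\<Delta> c \<in> carrier CC" by (rule linear_mapsD(1)[OF \<Delta> c(1)])
    show "tensor_lift Cx (\<lambda>X s. s \<odot>\<^bsub>Cx\<^esub> X) (tensor_map S Cx (regular_module S) id ?\<epsilon> (?\<Delta> X)) = X"
      unfolding c(2) stalk_comult_q[OF \<Delta> c(1)] right[OF \<Delta>c] K.counit_right[OF c(1)] by (rule refl)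
    show "tensor_lift Cx (\<lambda>s X. s \<odot>\<^bsub>Cx\<^esub> X) (tensor_map S (regular_module S) Cx ?\<epsilon> id (?\<Delta> X)) = X"
      unfolding c(2) stalk_comult_q[OF \<Delta> c(1)] left[OF \<Delta>c] K.counit_left[OF c(1)] by (rule refl)
  qed
qed

end

section \<open>Homomorphisms of coalgebras on stalks\<close>

lemma (in manifold_point) stalk_coalgebra_hom:
  fixes C :: "('m \<Rightarrow> 'f, 'c) module" and D :: "('m \<Rightarrow> 'f, 'd) module"
  assumes C: "coalgebra R C \<Delta> \<epsilon>" and D: "coalgebra R D \<Delta>' \<epsilon>'"
    and hom: "coalgebra_hom R C \<Delta> \<epsilon> D \<Delta>' \<epsilon>' \<alpha>"
  shows "coalgebra_hom S
    (stalk n A x C) (stalk_comult n A x C \<Delta>) (stalk_counit n A x \<epsilon>)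
    (stalk n A x D) (stalk_comult n A x D \<Delta>') (stalk_counit n A x \<epsilon>') (stalk_map n A x D \<alpha>)"
proof -
  have C_stalk: "stalk_module n A x R S C" and D_stalk: "stalk_module n A x R S D"
    using C D by (auto simp: coalgebra_def intro: stalk_module.intro manifold_point_axioms)
  interpret C: stalk_module n A x R S C by (rule C_stalk)
  interpret D: stalk_module n A x R S D by (rule D_stalk)
  note \<Delta> = coalgebra.comult_linear[OF C] and \<Delta>' = coalgebra.comult_linear[OF D]
  note \<epsilon> = coalgebra.counit_linear[OF C] and \<epsilon>' = coalgebra.counit_linear[OF D]
  have \<alpha>: "\<alpha> \<in> linear_maps R C D" and \<alpha>\<Delta>: "\<And>c. c \<in> carrier C \<Longrightarrow> tensor_map R D D \<alpha> \<alpha> (\<Delta> c) = \<Delta>' (\<alpha> c)"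
    and \<alpha>\<epsilon>: "\<And>c. c \<in> carrier C \<Longrightarrow> \<epsilon>' (\<alpha> c) = \<epsilon> c"
    using hom by (auto simp: coalgebra_hom_def)
  let ?\<alpha> = "stalk_map n A x D \<alpha>"
  note \<alpha>q = stalk_map_q[OF C_stalk D_stalk \<alpha>] and \<alpha>' = linear_mapsD[OF \<alpha>]
  have \<alpha>x: "?\<alpha> \<in> linear_maps S C.Cx D.Cx"
  proof (rule linear_mapsI)
    show "?\<alpha> X \<in> carrier D.Cx" if "X \<in> carrier C.Cx" for X
      using that by (auto simp: C.Cx_carrier \<alpha>q D.q_closed \<alpha>')
    show "?\<alpha> (X \<oplus>\<^bsub>C.Cx\<^esub> Y) = ?\<alpha> X \<oplus>\<^bsub>D.Cx\<^esub> ?\<alpha> Y"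
      if "X \<in> carrier C.Cx" "Y \<in> carrier C.Cx" for X Y
      using that by (auto simp: C.Cx_carrier \<alpha>q \<alpha>' C.q_add D.q_add)
    show "?\<alpha> (s \<odot>\<^bsub>C.Cx\<^esub> X) = s \<odot>\<^bsub>D.Cx\<^esub> ?\<alpha> X"
      if "s \<in> carrier S" "X \<in> carrier C.Cx" for s X
      using that
      by (auto simp: C.Cx_carrier germ_carrier \<alpha>q \<alpha>' C.Cx_smult D.Cx_smult C.C.smult_closed)
  qed
  note C_mod = C.C.locally_unitary_module_axioms and D_mod = D.C.locally_unitary_module_axioms
    and Cx_mod = C.stalk_locally_unitary and Dx_mod = D.stalk_locally_unitary
  \<comment> \<open>Naturality of \<tau>: on c \<otimes> d both sides are the tensor of the classes
    of \<alpha> c and \<alpha> d. At t = \<Delta> c it carries the compatibility of \<alpha> with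
    the comultiplications over to the stalks.\<close>
  have eq: "tensor_map S D.Cx D.Cx ?\<alpha> ?\<alpha> (C.\<tau> t) = D.\<tau> (tensor_map R D D \<alpha> \<alpha> t)"
    if "t \<in> carrier C.CC" for t
    using _ _ _ that
  proof (rule module_pair.tensor_hom_eqI[OF C.tensor_pair])
    show "(\<lambda>t. tensor_map S D.Cx D.Cx ?\<alpha> ?\<alpha> (C.\<tau> t)) \<in> hom (add_monoid C.CC) (add_monoid D.CCx)"
      by (rule hom_add_comp[OF C.\<tau>_hom tensor_map_hom[OF Cx_mod Cx_mod Dx_mod Dx_mod \<alpha>x \<alpha>x]])
    show "(\<lambda>t. D.\<tau> (tensor_map R D D \<alpha> \<alpha> t)) \<in> hom (add_monoid C.CC) (add_monoid D.CCx)"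
      by (rule hom_add_comp[OF tensor_map_hom[OF C_mod C_mod D_mod D_mod \<alpha> \<alpha>] D.\<tau>_hom])
    show "tensor_map S D.Cx D.Cx ?\<alpha> ?\<alpha> (C.\<tau> (pure_tensor R C C c d)) =
        D.\<tau> (tensor_map R D D \<alpha> \<alpha> (pure_tensor R C C c d))"
      if "c \<in> carrier C" "d \<in> carrier C" for c d
      using that
      by (simp add: C.\<tau>_pure D.\<tau>_pure tensor_map_pure[OF C_mod C_mod D_mod D_mod \<alpha> \<alpha>]
          tensor_map_pure[OF Cx_mod Cx_mod Dx_mod Dx_mod \<alpha>x \<alpha>x] C.q_closed \<alpha>q \<alpha>')
  qed
  show ?thesis
    unfolding coalgebra_hom_def
  proof (intro conjI ballI \<alpha>x)
    fix X assume "X \<in> carrier C.Cx"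
    then obtain c where c: "c \<in> carrier C" "X = C.q c" by (auto simp: C.Cx_carrier)
    show "tensor_map S D.Cx D.Cx ?\<alpha> ?\<alpha> (stalk_comult n A x C \<Delta> X) = stalk_comult n A x D \<Delta>' (?\<alpha> X)"
      using c eq[OF linear_mapsD(1)[OF \<Delta> c(1)]]
      by (simp add: C.stalk_comult_q[OF \<Delta>] D.stalk_comult_q[OF \<Delta>'] \<alpha>q \<alpha>' \<alpha>\<Delta>)
    show "stalk_counit n A x \<epsilon>' (?\<alpha> X) = stalk_counit n A x \<epsilon> X"
      using c by (simp add: C.stalk_counit_q[OF \<epsilon>] D.stalk_counit_q[OF \<epsilon>'] \<alpha>q \<alpha>' \<alpha>\<epsilon>)
  qed
qed

theorem proposition2p2:
  fixes n :: nat
    and A :: "'m::t2_space chart set"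
    and C :: "('m \<Rightarrow> 'f::real_normed_field, 'c) module"
    and \<Delta> :: "'c \<Rightarrow> (('c \<times> 'c) \<Rightarrow>\<^sub>0 int) set"
    and \<epsilon> :: "'c \<Rightarrow> 'm \<Rightarrow> 'f"
    and x :: 'm
  assumes "smooth_atlas n A"
    and "coalgebra (Cc_ring n A) C \<Delta> \<epsilon>"
  shows "coalgebra (germ_ring n A x :: ('m \<Rightarrow> 'f) set ring)
           (stalk n A x C) (stalk_comult n A x C \<Delta>) (stalk_counit n A x \<epsilon>) \<and>
    (\<forall>(D :: ('m \<Rightarrow> 'f, 'd) module) \<Delta>' \<epsilon>' \<alpha>.
       coalgebra (Cc_ring n A) D \<Delta>' \<epsilon>' \<longrightarrow>
       coalgebra_hom (Cc_ring n A) C \<Delta> \<epsilon> D \<Delta>' \<epsilon>' \<alpha> \<longrightarrow>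
       coalgebra_hom (germ_ring n A x)
         (stalk n A x C) (stalk_comult n A x C \<Delta>) (stalk_counit n A x \<epsilon>)
         (stalk n A x D) (stalk_comult n A x D \<Delta>') (stalk_counit n A x \<epsilon>')
         (stalk_map n A x D \<alpha>))"
proof -
  have C_mod: "locally_unitary_module (Cc_ring n A) C"
    using assms(2) by (simp add: coalgebra_def)
  then have point: "manifold_point n A x (Cc_ring n A :: ('m \<Rightarrow> 'f) ring) (germ_ring n A x)"
    using assms(1) by (simp add: manifold_point_def locally_unitary_module_def)
  show ?thesis
    using stalk_module.stalk_coalgebra[OF stalk_module.intro[OF point C_mod] assms(2)]
      manifold_point.stalk_coalgebra_hom[OF point assms(2)]
    by blast
qed

end
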